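(* Let $\mathcal X$ be a reflexive Banach space and let $A\subset \mathcal X\times\mathcal X^*$ be a nonempty monotone operator. Let $D:=\overline{\mathrm{co}}(\mathrm D(A))$ be the closed convex hull of its domain, let $C:=D\times\mathcal X^*$, and let $$f:\mathcal X\times\mathcal X^*\to(-\infty,+\infty],\qquad f(x,v):=\mathsf f_A(x,v)+\mathrm I_C(x,v).$$ Let $\psi:\mathcal X\times\mathcal X^*\to[0,+\infty)$ be a self-dual kernel. Then the following hold: 1. $f$ is a lower semicontinuous and convex function such that $\mathsf f_A\le f\le \mathsf p_A^\top$ on $\mathcal X\times\mathcal X^*$. 2. $\mathrm D(f)\subset C=D\times\mathcal X^*$ and $\mathrm D(f^* )\subset \mathcal X^*\times D$. 3. Defining $$R_f(x,v):=\min\Big\{\tfrac12 f(x_1,v_1)+\tfrac12 f^*(v_2,x_2)+\tfrac14\psi(x_1-x_2,v_1-v_2)\ :\ (x,v)=\tfrac12(x_1+x_2,v_1+v_2)\Big\}$$ and $\tilde A:=\{(x,v)\in\mathcal X\times\mathcal X^*: R_f(x,v)=\langle v,x\rangle\}$, one has $\mathrm D(R_f)\subset C=D\times\mathcal X^*$, and $\tilde A$ is a maximal monotone extension of $A$ with domain $\mathrm D(\tilde A)\subset D$.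
   Context: $\mathcal X$ is a reflexive Banach space with dual $\mathcal X^*$ and duality pairing $\langle v,x\rangle$ ($v\in\mathcal X^*$, $x\in\mathcal X$). The product $\mathcal Z:=\mathcal X\times\mathcal X^*$ has dual $\mathcal Z^*=\mathcal X^*\times\mathcal X$. A multivalued operator is identified with its graph $A\subset\mathcal X\times\mathcal X^*$. It is monotone if $\langle v-w,x-y\rangle\ge0$ for all $(x,v),(y,w)\in A$; it is maximal monotone if it is monotone and every monotone subset of $\mathcal X\times\mathcal X^*$ containing it coincides with it. $\mathrm D(A)$ is the projection of $A$ on $\mathcal X$. A maximal monotone extension of $A$ is a maximal monotone operator containing $A$. For an extended-real-valued function $h$, $\mathrm D(h)=\{h<+\infty\}$. $\mathrm I_C$ is the indicator function ($0$ on $C$, $+\infty$ outside $C$). For a proper $g:\mathcal X\times\mathcal X^*\to(-\infty,+\infty]$, the conjugate $g^*:\mathcal X^*\times\mathcal X\to(-\infty,+\infty]$ is $g^*(v,x)=\sup_{(x_0,v_0)}\{\langle v_0,x\rangle+\langle v,x_0\rangle-g(x_0,v_0)\}$; analogously for functions on $\mathcal X^*\times\mathcal X$. For a function $h$ on $\mathcal X^*\times\mathcal X$, $h^\top(x,v):=h(v,x)$. Set $\mathsf c_A(v,x):=\langle v,x\rangle$ if $(x,v)\in A$ and $+\infty$ otherwise (a function on $\mathcal X^*\times\mathcal X$), $\mathsf f_A:=\mathsf c_A^*$ (the Fitzpatrick function, on $\mathcal X\times\mathcal X^*$) and $\mathsf p_A:=\mathsf f_A^*=\mathsf c_A^{**}$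 (on $\mathcal X^*\times\mathcal X$). A self-dual kernel is a function $\psi:\mathcal X\times\mathcal X^*\to[0,+\infty)$ such that $\psi(-z)=\psi(z)$ for all $z$ and $\psi=(\psi^* )^\top$, i.e. $\psi(x,v)=\psi^*(v,x)$ (an example is $\psi(x,v)=\frac1p|x|^p+\frac1{p^*}|v|_*^{p^*}$ with conjugate exponents $p,p^*\in(1,\infty)$). *)

theory Defs
  imports "HOL-Analysis.Analysis"
begin

type_synonym 'a dual = "'a \<Rightarrow>\<^sub>L real"

text \<open>The map \<open>blinfun.prod_left :: 'a \<Rightarrow> 'a dual dual\<close> sends \<open>x\<close> to \<open>\<lambda>v. v x\<close>, i.e. it is the
  canonical embedding into the bidual.\<close>

definition reflexive :: "'a::real_normed_vector itself \<Rightarrow> bool" where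
  "reflexive TYPE('a) \<longleftrightarrow> surj (blinfun.prod_left :: 'a \<Rightarrow> 'a dual dual)"

definition monotone_operator :: "('a::real_normed_vector \<times> 'a dual) set \<Rightarrow> bool" where
  "monotone_operator A \<longleftrightarrow>
     (\<forall>(x, v)\<in>A. \<forall>(y, w)\<in>A. 0 \<le> blinfun_apply (v - w) (x - y))"

definition maximal_monotone_operator :: "('a::real_normed_vector \<times> 'a dual) set \<Rightarrow> bool" where
  "maximal_monotone_operator A \<longleftrightarrow>
     monotone_operator A \<and> (\<forall>B. monotone_operator B \<and> A \<subseteq> B \<longrightarrow> B = A)"

definition eff_domain :: "('b \<Rightarrow> ereal) \<Rightarrow> 'b set" where
  "eff_domain h = {z. h z < \<infinity>}"

definition indicator_ereal :: "'b set \<Rightarrow> 'b \<Rightarrow> ereal" where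
  "indicator_ereal S z = (if z \<in> S then 0 else \<infinity>)"

definition lower_semicontinuous :: "('b::topological_space \<Rightarrow> ereal) \<Rightarrow> bool" where
  "lower_semicontinuous h \<longleftrightarrow> (\<forall>z. h z \<le> Liminf (at z) h)"

text \<open>Convexity is only meaningful here for functions that never take the value \<open>-\<infinity>\<close>, since
  \<open>\<infinity> + (-\<infinity>)\<close> is a junk value of \<^typ>\<open>ereal\<close>.\<close>

definition convex_ereal :: "('b::real_vector \<Rightarrow> ereal) \<Rightarrow> bool" where
  "convex_ereal h \<longleftrightarrow>
     (\<forall>y z. \<forall>t\<in>{0<..<1::real}.
        h ((1 - t) *\<^sub>R y + t *\<^sub>R z) \<le> ereal (1 - t) * h y + ereal t * h z)"

text \<open>Conjugation from functions on \<open>X \<times> X*\<close> to functions on \<open>X* \<times> X\<close>, and in the other direction;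
  reflexivity is built in through the identification of the dual of \<open>X* \<times> X\<close> with \<open>X \<times> X*\<close>.\<close>

definition conjugate :: "('a::real_normed_vector \<times> 'a dual \<Rightarrow> ereal) \<Rightarrow> 'a dual \<times> 'a \<Rightarrow> ereal" where
  "conjugate g = (\<lambda>(v, x). SUP (x0, v0). 
     ereal (blinfun_apply v0 x + blinfun_apply v x0) - g (x0, v0))"

definition conjugate_dual :: "('a::real_normed_vector dual \<times> 'a \<Rightarrow> ereal) \<Rightarrow> 'a \<times> 'a dual \<Rightarrow> ereal" where
  "conjugate_dual h = (\<lambda>(x, v). SUP (v0, x0). 
     ereal (blinfun_apply v0 x + blinfun_apply v x0) - h (v0, x0))"

definition swap_args :: "('a dual \<times> 'a::real_normed_vector \<Rightarrow> ereal) \<Rightarrow> 'a \<times> 'a dual \<Rightarrow> ereal" where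
  "swap_args h = (\<lambda>(x, v). h (v, x))"

definition c_op :: "('a::real_normed_vector \<times> 'a dual) set \<Rightarrow> 'a dual \<times> 'a \<Rightarrow> ereal" where
  "c_op A = (\<lambda>(v, x). if (x, v) \<in> A then ereal (blinfun_apply v x) else \<infinity>)"

definition fitzpatrick :: "('a::real_normed_vector \<times> 'a dual) set \<Rightarrow> 'a \<times> 'a dual \<Rightarrow> ereal" where
  "fitzpatrick A = conjugate_dual (c_op A)"

definition p_op :: "('a::real_normed_vector \<times> 'a dual) set \<Rightarrow> 'a dual \<times> 'a \<Rightarrow> ereal" where
  "p_op A = conjugate (fitzpatrick A)"

definition self_dual_kernel :: "('a::real_normed_vector \<times> 'a dual \<Rightarrow> real) \<Rightarrow> bool" where
  "self_dual_kernel \<psi> \<longleftrightarrow>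
     (\<forall>z. 0 \<le> \<psi> z) \<and> (\<forall>z. \<psi> (- z) = \<psi> z) \<and>
     (\<lambda>z. ereal (\<psi> z)) = swap_args (conjugate (\<lambda>z. ereal (\<psi> z)))"

definition R_cost ::
  "('a::real_normed_vector \<times> 'a dual \<Rightarrow> real) \<Rightarrow> ('a \<times> 'a dual \<Rightarrow> ereal) \<Rightarrow>
     'a \<times> 'a dual \<Rightarrow> 'a \<times> 'a dual \<Rightarrow> ereal" where
  "R_cost \<psi> f = (\<lambda>(x1, v1) (x2, v2).
     ereal (1/2) * f (x1, v1) + ereal (1/2) * conjugate f (v2, x2)
       + ereal (1/4 * \<psi> (x1 - x2, v1 - v2)))"

text \<open>Defined as an infimum; attainment has to be stated separately.\<close>

definition R_fun ::
  "('a::real_normed_vector \<times> 'a dual \<Rightarrow> real) \<Rightarrow> ('a \<times> 'a dual \<Rightarrow> ereal) \<Rightarrow> 'a \<times> 'a dual \<Rightarrow> ereal" where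
  "R_fun \<psi> f z = (INF (z1, z2)\<in>{(z1, z2). z = (1/2) *\<^sub>R (z1 + z2)}. R_cost \<psi> f z1 z2)"

end

theory Submission
  imports Defs
begin

text \<open>
  The pairing on \<open>X \<times> X*\<close> given by \<open>pairing (x, v) (y, u) = <v, y> + <u, x>\<close> represents, by reflexivity,
  every continuous linear functional, so conjugation followed by transposition (\<open>tconj\<close>) acts on
  functions on \<open>X \<times> X*\<close>. Half its quadratic form is the duality product \<open><v, x>\<close>.

  The heart of the matter is that the function \<open>R\<close> built from \<open>f\<close>, its conjugate and a self-dual kernel
  is its own transposed conjugate. One inequality is Fenchel-Young
  (\<open>R_fun_Fenchel_Young\<close>). The other one is strong duality (\<open>R_cost_attains_conjugate\<close>): computing the
  conjugate of \<open>R\<close> interchanges the roles of \<open>f\<close> and \<open>tconj f\<close> and reproduces the same expression,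
  with an infimum that is attained. Hence duality, not weak compactness, provides the minimisers in the
  definition of \<open>R\<close>. Strong duality requires the kernel to be bounded above near some point, which
  follows from Baire's theorem because it is finite everywhere and lower semicontinuous.

  A self-dual \<open>R\<close> satisfies \<open>R z \<ge> pairing z z / 2\<close>, i.e. it lies above the duality product, and the
  set where the two coincide is then maximal monotone
  (\<open>self_dual_representative_maximal_monotone\<close>). On \<open>A\<close> both \<open>f\<close> and \<open>tconj f\<close> are at most the duality
  product and the kernel vanishes at \<open>0\<close>, so the trivial decomposition \<open>z = (z + z) / 2\<close> shows that \<open>A\<close>
  is contained in this set.

  For the domains, \<open>f\<close> is infinite off \<open>D \<times> X*\<close> by construction. The conjugate of \<open>f\<close> has the same
  property by separation: a functional that separates \<open>x\<close> from \<open>D\<close> is a direction along which \<open>f\<close> grows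
  too slowly for the conjugate to be finite (\<open>conjugate_restricted_fitzpatrick_domain\<close>). A point where
  \<open>R\<close> is finite is the midpoint of a point of each domain, and \<open>D\<close> is convex.

  All the duality rests on one consequence of the Hahn-Banach theorem, \<open>convex_sandwich\<close>: Fenchel-Moreau
  biconjugation, separation, norming functionals and strong duality are obtained from it.
\<close>

section \<open>The Hahn-Banach theorem\<close>

definition sublinear :: "('e::real_vector \<Rightarrow> real) \<Rightarrow> bool" where
  "sublinear p \<longleftrightarrow> (\<forall>x y. p (x + y) \<le> p x + p y) \<and> (\<forall>t x. 0 < t \<longrightarrow> p (t *\<^sub>R x) = t * p x)"

lemma sublinear_add: "sublinear p \<Longrightarrow> p (x + y) \<le> p x + p y"
  and sublinear_scale: "sublinear p \<Longrightarrow> 0 < t \<Longrightarrow> p (t *\<^sub>R x) = t * p x"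
  by (auto simp: sublinear_def)

lemma sublinear_zero:
  assumes "sublinear p" shows "p 0 = 0"
  using sublinear_scale[OF assms, of 2 0] by simp

lemma sublinear_scale_nonneg: "sublinear p \<Longrightarrow> 0 \<le> t \<Longrightarrow> p (t *\<^sub>R x) = t * p x"
  using sublinear_zero[of p] sublinear_scale[of p t x] by (cases "t = 0") auto

lemma sublinear_minus: "sublinear p \<Longrightarrow> - p (- x) \<le> p x"
  using sublinear_add[of p x "- x"] sublinear_zero[of p] by simp

text \<open>One inequality is enough for homogeneity: apply it to \<open>t\<close> and to \<open>1 / t\<close>.\<close>

lemma sublinearI:
  assumes add: "\<And>x y. p (x + y) \<le> p x + p y"
    and scale: "\<And>t x. 0 < t \<Longrightarrow> p (t *\<^sub>R x) \<le> t * p x"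
  shows "sublinear p"
  unfolding sublinear_def
proof (intro conjI allI impI)
  fix t :: real and x assume t: "0 < t"
  have "p ((1 / t) *\<^sub>R (t *\<^sub>R x)) \<le> (1 / t) * p (t *\<^sub>R x)"
    using t by (intro scale) auto
  then have "t * p x \<le> p (t *\<^sub>R x)"
    using t by (simp add: field_simps)
  then show "p (t *\<^sub>R x) = t * p x"
    using scale[OF t, of x] by simp
qed (rule add)

text \<open>Along a chain the infimum is again sublinear, because two members of the chain can be compared
  and the smaller one used for both summands; the bound \<open>- p (- x)\<close> keeps it finite.\<close>

lemma sublinear_chain_infimum:
  fixes C :: "('e::real_vector \<Rightarrow> real) set"
  assumes ne: "C \<noteq> {}" and sub: "\<And>q. q \<in> C \<Longrightarrow> sublinear q \<and> q \<le> p"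
    and chain: "\<And>q r. q \<in> C \<Longrightarrow> r \<in> C \<Longrightarrow> q \<le> r \<or> r \<le> q"
  shows "sublinear (\<lambda>x. INF q\<in>C. q x)" and "\<And>q. q \<in> C \<Longrightarrow> (\<lambda>x. INF q\<in>C. q x) \<le> q"
proof -
  have bdd: "bdd_below ((\<lambda>q. q x) ` C)" for x
  proof (rule bdd_belowI2)
    fix q assume "q \<in> C"
    then show "- p (- x) \<le> q x"
      using sub[of q] sublinear_minus[of q x] by (auto simp: le_fun_def) (smt (verit))
  qed
  have low: "(INF q\<in>C. q x) \<le> q x" if "q \<in> C" for q x
    using that by (intro cINF_lower bdd)
  show "sublinear (\<lambda>x. INF q\<in>C. q x)"
  proof (rule sublinearI)
    fix x y
    have "(INF q\<in>C. q (x + y)) - q x \<le> r y" if q: "q \<in> C" and r: "r \<in> C" for q r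
    proof -
      obtain s where s: "s \<in> C" "s \<le> q" "s \<le> r"
        using chain[OF q r] q r by blast
      have "(INF q\<in>C. q (x + y)) \<le> s x + s y"
        using low[OF s(1), of "x + y"] sub[OF s(1)] sublinear_add[of s x y] by linarith
      then show ?thesis
        using s(2,3) by (auto simp: le_fun_def) (smt (verit))
    qed
    then have "(INF q\<in>C. q (x + y)) - q x \<le> (INF q\<in>C. q y)" if "q \<in> C" for q
      using that by (intro cINF_greatest[OF ne]) auto
    then have "(INF q\<in>C. q (x + y)) - (INF q\<in>C. q y) \<le> (INF q\<in>C. q x)"
      by (intro cINF_greatest[OF ne]) (auto simp: algebra_simps)
    then show "(INF q\<in>C. q (x + y)) \<le> (INF q\<in>C. q x) + (INF q\<in>C. q y)"
      by simp
  next
    fix t :: real and x :: 'e assume t: "0 < t"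
    have "(INF q\<in>C. q (t *\<^sub>R x)) / t \<le> (INF q\<in>C. q x)"
    proof (rule cINF_greatest[OF ne])
      fix q assume q: "q \<in> C"
      show "(INF q\<in>C. q (t *\<^sub>R x)) / t \<le> q x"
        using low[OF q, of "t *\<^sub>R x"] sub[OF q] sublinear_scale[of q t x] t
        by (simp add: field_simps)
    qed
    then show "(INF q\<in>C. q (t *\<^sub>R x)) \<le> t * (INF q\<in>C. q x)"
      using t by (simp add: field_simps)
  qed
  show "\<And>q. q \<in> C \<Longrightarrow> (\<lambda>x. INF q\<in>C. q x) \<le> q"
    using low by (auto simp: le_fun_def)
qed

text \<open>For fixed \<open>y\<close> the function \<open>x \<mapsto> INF t\<ge>0. q (x + t y) - t q y\<close> is sublinear and below \<open>q\<close>.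
  Minimality forces equality, and the value \<open>t = 1\<close> then reads \<open>q x + q y \<le> q (x + y)\<close>.\<close>

lemma minimal_sublinear_is_linear:
  fixes q :: "'e::real_vector \<Rightarrow> real"
  assumes q: "sublinear q" and min: "\<And>r. sublinear r \<Longrightarrow> r \<le> q \<Longrightarrow> r = q"
  shows "linear q"
proof -
  have super: "q x + q y \<le> q (x + y)" for x y
  proof -
    define r where "r = (\<lambda>x. INF t\<in>{0..}. q (x + t *\<^sub>R y) - t * q y)"
    have bdd: "bdd_below ((\<lambda>t. q (x + t *\<^sub>R y) - t * q y) ` {0..})" for x
    proof (rule bdd_belowI2)
      fix t :: real assume "t \<in> {0..}"
      then show "- q (- x) \<le> q (x + t *\<^sub>R y) - t * q y"
        using sublinear_add[OF q, of "x + t *\<^sub>R y" "- x"] sublinear_scale_nonneg[OF q, of t y] by simp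
    qed
    have low: "r x \<le> q (x + t *\<^sub>R y) - t * q y" if "0 \<le> t" for x t
      unfolding r_def using that by (intro cINF_lower bdd) auto
    have great: "c \<le> r x" if "\<And>t. 0 \<le> t \<Longrightarrow> c \<le> q (x + t *\<^sub>R y) - t * q y" for c x
      unfolding r_def using that by (intro cINF_greatest) auto
    have "sublinear r"
    proof (rule sublinearI)
      fix a b
      have "r (a + b) - (q (a + s *\<^sub>R y) - s * q y) \<le> q (b + t *\<^sub>R y) - t * q y"
        if "0 \<le> s" "0 \<le> t" for s t
        using low[of "s + t" "a + b"] that sublinear_add[OF q, of "a + s *\<^sub>R y" "b + t *\<^sub>R y"]
        by (simp add: algebra_simps)
      then have "r (a + b) - (q (a + s *\<^sub>R y) - s * q y) \<le> r b" if "0 \<le> s" for s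
        using that by (intro great) auto
      then have "r (a + b) - r b \<le> q (a + s *\<^sub>R y) - s * q y" if "0 \<le> s" for s
        using that by (auto simp: algebra_simps)
      then have "r (a + b) - r b \<le> r a"
        by (rule great)
      then show "r (a + b) \<le> r a + r b" by simp
    next
      fix t :: real and a assume t: "0 < t"
      have "r (t *\<^sub>R a) / t \<le> r a"
      proof (rule great)
        fix s :: real assume s: "0 \<le> s"
        have "r (t *\<^sub>R a) \<le> q (t *\<^sub>R (a + s *\<^sub>R y)) - t * s * q y"
          using low[of "t * s" "t *\<^sub>R a"] s t by (simp add: algebra_simps)
        also have "\<dots> = t * (q (a + s *\<^sub>R y) - s * q y)"
          by (simp add: sublinear_scale[OF q t] right_diff_distrib)
        finally show "r (t *\<^sub>R a) / t \<le> q (a + s *\<^sub>R y) - s * q y"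
          using t by (simp add: field_simps)
      qed
      then show "r (t *\<^sub>R a) \<le> t * r a"
        using t by (simp add: field_simps)
    qed
    moreover have "r \<le> q"
      using low[of 0] by (simp add: le_fun_def)
    ultimately have "r = q" by (rule min)
    then show ?thesis using low[of 1 x] by simp
  qed
  then have add: "q (x + y) = q x + q y" for x y
    using sublinear_add[OF q, of x y] by (simp add: antisym)
  have neg: "q (- x) = - q x" for x
    using add[of x "- x"] sublinear_zero[OF q] by simp
  show ?thesis
  proof (rule linearI)
    fix t :: real and x
    show "q (t *\<^sub>R x) = t *\<^sub>R q x"
    proof (cases "0 \<le> t")
      case False
      then have "q ((- t) *\<^sub>R (- x)) = - t * q (- x)"
        by (intro sublinear_scale_nonneg[OF q]) simp
      then show ?thesis using neg[of x] by simp
    qed (simp add: sublinear_scale_nonneg[OF q])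
  qed (rule add)
qed

text \<open>The Hahn-Banach theorem without subspaces: by Zorn's lemma a minimal sublinear functional lies
  below \<open>p\<close>, and it is already linear.\<close>

theorem sublinear_dominates_linear:
  fixes p :: "'e::real_vector \<Rightarrow> real"
  assumes p: "sublinear p"
  shows "\<exists>l. linear l \<and> (\<forall>x. l x \<le> p x)"
proof -
  define S where "S = {q. sublinear q \<and> q \<le> p}"
  define P :: "('e \<Rightarrow> real) \<Rightarrow> ('e \<Rightarrow> real) \<Rightarrow> bool" where "P = (\<lambda>a b. b \<le> a)"
  have "\<exists>m\<in>S. \<forall>a\<in>S. P m a \<longrightarrow> a = m"
  proof (rule predicate_Zorn)
    show "partial_order_on S (relation_of P S)"
      by (intro partial_order_on_relation_ofI) (auto simp: P_def)
    fix C assume C: "C \<in> Chains (relation_of P S)"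
    then have CS: "C \<subseteq> S" by (rule Chains_relation_of)
    show "\<exists>u\<in>S. \<forall>a\<in>C. P a u"
    proof (cases "C = {}")
      case True
      then show ?thesis using p by (auto simp: S_def)
    next
      case False
      have chain: "\<And>q r. q \<in> C \<Longrightarrow> r \<in> C \<Longrightarrow> q \<le> r \<or> r \<le> q"
        using C by (auto simp: Chains_def relation_of_def P_def)
      have sub: "\<And>q. q \<in> C \<Longrightarrow> sublinear q \<and> q \<le> p"
        using CS by (auto simp: S_def)
      note inf = sublinear_chain_infimum[OF False sub chain]
      obtain q where "q \<in> C" using False by blast
      then have "(\<lambda>x. INF q\<in>C. q x) \<le> p"
        using inf(2)[of q] sub[of q] order_trans by blast
      then have "(\<lambda>x. INF q\<in>C. q x) \<in> S"
        unfolding S_def using inf(1) by blast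
      then show ?thesis
        using inf(2) unfolding P_def by blast
    qed
  qed
  then obtain m where m: "m \<in> S" and max: "\<And>a. a \<in> S \<Longrightarrow> a \<le> m \<Longrightarrow> a = m"
    unfolding P_def by blast
  have "linear m"
  proof (rule minimal_sublinear_is_linear)
    show "sublinear m" using m by (simp add: S_def)
    fix r assume "sublinear r" "r \<le> m"
    with m show "r = m"
      by (intro max) (auto simp: S_def)
  qed
  then show ?thesis
    using m by (auto simp: S_def le_fun_def)
qed

text \<open>The functional is found below \<open>p u = inf {s r | s > 0, (u / s, r) \<in> W}\<close>, the gauge of the cone
  generated by \<open>W\<close>. The hypothesis on the fibre over \<open>0\<close> keeps \<open>p\<close> away from \<open>-\<infinity>\<close>, the surjectivity of
  the projection of \<open>W\<close> keeps it away from \<open>+\<infinity>\<close>.\<close>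

lemma convex_set_linear_minorant:
  fixes W :: "('e::real_vector \<times> real) set"
  assumes W: "convex W" and fibre: "\<And>r. (0, r) \<in> W \<Longrightarrow> 0 \<le> r"
    and onto: "\<And>u. \<exists>r. (u, r) \<in> W"
  shows "\<exists>l. linear l \<and> (\<forall>(u, r)\<in>W. l u \<le> r)"
proof -
  define K where "K u = {r. \<exists>s>0. \<exists>(w, t)\<in>W. u = s *\<^sub>R w \<and> r = s * t}" for u
  have ne: "K u \<noteq> {}" for u
  proof -
    obtain r where "(u, r) \<in> W" using onto by blast
    then have "r \<in> K u"
      unfolding K_def by (intro CollectI exI[of _ 1] conjI bexI[of _ "(u, r)"]) auto
    then show ?thesis by blast
  qed
  have K_scale: "t * r \<in> K (t *\<^sub>R u)" if t: "0 < t" and r: "r \<in> K u" for t r u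
  proof -
    obtain s w q where "s > 0" "(w, q) \<in> W" "u = s *\<^sub>R w" "r = s * q"
      using r by (auto simp: K_def)
    then show ?thesis
      unfolding K_def using t
      by (intro CollectI exI[of _ "t * s"] conjI bexI[of _ "(w, q)"]) auto
  qed
  have K_add: "r + r' \<in> K (u + u')" if r: "r \<in> K u" and r': "r' \<in> K u'" for r r' u u'
  proof -
    obtain s w q where 1: "s > 0" "(w, q) \<in> W" "u = s *\<^sub>R w" "r = s * q"
      using r by (auto simp: K_def)
    obtain s' w' q' where 2: "s' > 0" "(w', q') \<in> W" "u' = s' *\<^sub>R w'" "r' = s' * q'"
      using r' by (auto simp: K_def)
    let ?a = "s / (s + s')" and ?b = "s' / (s + s')"
    have "?a *\<^sub>R (w, q) + ?b *\<^sub>R (w', q') \<in> W"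
      using 1 2 by (intro convexD[OF W]) (auto simp: add_divide_distrib[symmetric])
    then have "(?a *\<^sub>R w + ?b *\<^sub>R w', ?a * q + ?b * q') \<in> W" by simp
    moreover have "u + u' = (s + s') *\<^sub>R (?a *\<^sub>R w + ?b *\<^sub>R w')"
      using 1 2 by (simp add: scaleR_add_right)
    moreover have "r + r' = (s + s') * (?a * q + ?b * q')"
      using 1 2 by (simp add: distrib_left)
    ultimately show ?thesis
      unfolding K_def using 1(1) 2(1)
      by (intro CollectI exI[of _ "s + s'"] conjI bexI) auto
  qed
  have K0: "0 \<le> r" if "r \<in> K 0" for r
    using that fibre by (auto simp: K_def)
  have bdd: "bdd_below (K u)" for u
  proof -
    obtain r' where r': "r' \<in> K (- u)" using ne by blast
    have "- r' \<le> r" if "r \<in> K u" for r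
      using K0[of "r + r'"] K_add[OF that r'] by simp
    then show ?thesis by (rule bdd_belowI)
  qed
  define p where "p u = Inf (K u)" for u
  have low: "p u \<le> r" if "r \<in> K u" for u r
    unfolding p_def using that bdd by (intro cInf_lower)
  have great: "c \<le> p u" if "\<And>r. r \<in> K u \<Longrightarrow> c \<le> r" for c u
    unfolding p_def using that ne by (intro cInf_greatest)
  have "sublinear p"
  proof (rule sublinearI)
    fix x y
    have "p (x + y) - r \<le> s" if "r \<in> K x" "s \<in> K y" for r s
      using low[OF K_add[OF that]] by simp
    then have "p (x + y) - r \<le> p y" if "r \<in> K x" for r
      using that by (intro great) auto
    then have "p (x + y) - p y \<le> p x"
      by (intro great) (auto simp: algebra_simps)
    then show "p (x + y) \<le> p x + p y" by simp
  next
    fix t :: real and x assume t: "0 < t"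
    have "p (t *\<^sub>R x) / t \<le> p x"
    proof (rule great)
      fix r assume "r \<in> K x"
      then show "p (t *\<^sub>R x) / t \<le> r"
        using low[OF K_scale[OF t]] t by (simp add: field_simps)
    qed
    then show "p (t *\<^sub>R x) \<le> t * p x"
      using t by (simp add: field_simps)
  qed
  then obtain l where l: "linear l" "\<And>x. l x \<le> p x"
    using sublinear_dominates_linear by blast
  have "l u \<le> r" if "(u, r) \<in> W" for u r
  proof -
    have "r \<in> K u"
      unfolding K_def using that by (intro CollectI exI[of _ 1] conjI bexI[of _ "(u, r)"]) auto
    then show ?thesis using l(2)[of u] low order_trans by blast
  qed
  then show ?thesis using l(1) by auto
qed

lemma linear_bounded_above_on_ball:
  fixes l :: "'e::real_normed_vector \<Rightarrow> real"
  assumes l: "linear l" and d: "0 < d" and bound: "\<And>h. norm h < d \<Longrightarrow> l h \<le> M"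
  shows "bounded_linear l"
proof (rule bounded_linear_intro[where K = "2 * M / d"])
  fix x
  show "norm (l x) \<le> norm x * (2 * M / d)"
  proof (cases "x = 0")
    case True
    then show ?thesis using linear_0[OF l] by simp
  next
    case False
    define c where "c = d / (2 * norm x)"
    have c: "0 < c" "norm (c *\<^sub>R x) < d" "norm (c *\<^sub>R (- x)) < d"
      using False d by (auto simp: c_def)
    have "c * l x \<le> M" "- (c * l x) \<le> M"
      using bound[OF c(2)] bound[OF c(3)] linear_scale[OF l] linear_neg[OF l] by auto
    then have "c * \<bar>l x\<bar> \<le> M"
      using c(1) by (auto simp: abs_if)
    then have "\<bar>l x\<bar> \<le> M / c"
      using c(1) by (simp add: pos_le_divide_eq mult.commute)
    also have "\<dots> = norm x * (2 * M / d)"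
      using False d by (simp add: c_def)
    finally show ?thesis by simp
  qed
qed (simp_all add: linear_add[OF l] linear_scale[OF l])

text \<open>The Fenchel-Rockafellar duality theorem, with a convex set \<open>P\<close> in place of the epigraph of the
  first function, so that \<open>P\<close> may be the image of an epigraph under a linear map. Minorise the convex
  set of all \<open>(a - b, r + t)\<close> with \<open>(a, r) \<in> P\<close> and \<open>\<psi> b \<le> t\<close>: the hypothesis says that its fibre
  over \<open>0\<close> is nonnegative, and since \<open>\<psi>\<close> is finite its projection is everything.\<close>

theorem convex_sandwich:
  fixes P :: "('e::real_normed_vector \<times> real) set" and \<psi> :: "'e \<Rightarrow> real"
  assumes P: "convex P" "P \<noteq> {}" and \<psi>: "convex_on UNIV \<psi>"
    and d: "0 < d" and bound: "\<And>b. b \<in> ball b0 d \<Longrightarrow> \<psi> b \<le> M"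
    and nonneg: "\<And>a r. (a, r) \<in> P \<Longrightarrow> 0 \<le> r + \<psi> a"
  shows "\<exists>l. bounded_linear l \<and> (\<forall>(a, r)\<in>P. \<forall>b. l (a - b) \<le> r + \<psi> b)"
proof -
  define T :: "('e \<times> real) \<times> ('e \<times> real) \<Rightarrow> 'e \<times> real" where
    "T = (\<lambda>z. (fst (fst z) - fst (snd z), snd (fst z) + snd (snd z)))"
  define W where "W = T ` (P \<times> epigraph UNIV \<psi>)"
  have W_iff: "w \<in> W \<longleftrightarrow> (\<exists>a r b t. (a, r) \<in> P \<and> \<psi> b \<le> t \<and> w = (a - b, r + t))" for w
    by (simp add: W_def T_def epigraph_def image_iff Bex_def split_paired_Ex)
  have "linear T"
    by (rule linearI) (auto simp: T_def algebra_simps)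
  then have "convex W"
    unfolding W_def using P(1) \<psi> by (intro convex_linear_image convex_Times) (auto simp: convex_epigraph)
  moreover have "0 \<le> r" if "(0, r) \<in> W" for r
    using that nonneg by (fastforce simp: W_iff)
  moreover have "\<exists>r. (u, r) \<in> W" for u
  proof -
    obtain a r where "(a, r) \<in> P" using P(2) by auto
    then have "(u, r + \<psi> (a - u)) \<in> W"
      unfolding W_iff by (intro exI[of _ a] exI[of _ r] exI[of _ "a - u"] exI[of _ "\<psi> (a - u)"]) auto
    then show ?thesis ..
  qed
  ultimately obtain l where l: "linear l" and below: "\<And>u r. (u, r) \<in> W \<Longrightarrow> l u \<le> r"
    using convex_set_linear_minorant[of W] by blast
  have le: "l (a - b) \<le> r + \<psi> b" if "(a, r) \<in> P" for a r b
    using that by (intro below) (auto simp: W_iff)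
  obtain a r where ar: "(a, r) \<in> P" using P(2) by auto
  have "l h \<le> r + M - l (a - b0)" if "norm h < d" for h
  proof -
    have "l (a - (b0 - h)) \<le> r + \<psi> (b0 - h)"
      by (rule le[OF ar])
    also have "\<psi> (b0 - h) \<le> M"
      using that by (intro bound) (simp add: dist_norm)
    also have "a - (b0 - h) = (a - b0) + h" by simp
    finally show ?thesis using linear_add[OF l, of "a - b0" h] by simp
  qed
  then have "bounded_linear l"
    by (rule linear_bounded_above_on_ball[OF l d])
  then show ?thesis using le by blast
qed

section \<open>Affine minorants of convex functions\<close>

lemma convex_ereal_epigraph:
  fixes f :: "'e::real_vector \<Rightarrow> ereal"
  assumes f: "convex_ereal f"
  shows "convex {(z, r). f z \<le> ereal r}"
  unfolding convex_alt
proof (intro ballI allI impI)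
  fix x y :: "'e \<times> real" and u :: real
  assume x: "x \<in> {(z, r). f z \<le> ereal r}" and y: "y \<in> {(z, r). f z \<le> ereal r}" and u: "0 \<le> u \<and> u \<le> 1"
  obtain a r b s where xy: "x = (a, r)" "y = (b, s)" by (cases x, cases y)
  show "(1 - u) *\<^sub>R x + u *\<^sub>R y \<in> {(z, r). f z \<le> ereal r}"
  proof (cases "u = 0 \<or> u = 1")
    case True
    then show ?thesis using x y by auto
  next
    case False
    then have u': "u \<in> {0<..<1}" using u by auto
    have "f ((1 - u) *\<^sub>R a + u *\<^sub>R b) \<le> ereal (1 - u) * f a + ereal u * f b"
      using f u' unfolding convex_ereal_def by blast
    also have "\<dots> \<le> ereal (1 - u) * ereal r + ereal u * ereal s"
      using x y xy u' by (intro add_mono ereal_mult_left_mono) auto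
    finally show ?thesis using xy by simp
  qed
qed

lemma lower_semicontinuous_ball:
  fixes f :: "'e::metric_space \<Rightarrow> ereal"
  assumes f: "lower_semicontinuous f" and r: "r < f z0"
  shows "\<exists>d>0. \<forall>z\<in>ball z0 d. r < f z"
proof -
  have "\<forall>\<^sub>F z in at z0. r < f z"
    using f r unfolding lower_semicontinuous_def le_Liminf_iff by blast
  then obtain d where d: "d > 0" "\<And>z. z \<noteq> z0 \<Longrightarrow> dist z z0 < d \<Longrightarrow> r < f z"
    unfolding eventually_at by blast
  have "r < f z" if "z \<in> ball z0 d" for z
    using that d(2)[of z] r by (cases "z = z0") (auto simp: dist_commute)
  then show ?thesis using d(1) by blast
qed

lemma lower_semicontinuousI:
  assumes "\<And>r z. r < h z \<Longrightarrow> \<forall>\<^sub>F y in at z. r < h y"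
  shows "lower_semicontinuous h"
  using assms unfolding lower_semicontinuous_def le_Liminf_iff by blast

text \<open>A lower semicontinuous convex function is the supremum of its continuous affine minorants as
  soon as it has one of them. For \<open>r < f z0\<close> the function \<open>z \<mapsto> f z + n \<parallel>z - z0\<parallel>\<close> stays above \<open>r\<close>
  when \<open>n\<close> is large: near \<open>z0\<close> by semicontinuity, far from \<open>z0\<close> because the given minorant
  decreases at a limited rate. Sandwiching between \<open>f\<close> and \<open>r - n \<parallel>z - z0\<parallel>\<close> gives the minorant.\<close>

theorem affine_minorant_above:
  fixes f :: "'e::real_normed_vector \<Rightarrow> ereal"
  assumes conv: "convex_ereal f" and lsc: "lower_semicontinuous f" and proper: "f z1 < \<infinity>"
    and k: "bounded_linear k" and minorant: "\<And>z. ereal (k z + c) \<le> f z"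
    and r: "ereal r < f z0"
  shows "\<exists>l. bounded_linear l \<and> (\<forall>z. ereal (l (z - z0) + r) \<le> f z)"
proof -
  obtain d where d: "d > 0" "\<And>z. z \<in> ball z0 d \<Longrightarrow> ereal r < f z"
    using lower_semicontinuous_ball[OF lsc r] by blast
  obtain K where K: "K > 0" "\<And>x. norm (k x) \<le> norm x * K"
    using bounded_linear.pos_bounded[OF k] by blast
  define m where "m = max 0 ((r - k z0 - c) / d)"
  define n where "n = K + m"
  have m: "0 \<le> m" "r - k z0 - c \<le> m * d"
    using d(1) by (auto simp: m_def max_def field_simps)
  have n: "0 \<le> n" using m K by (simp add: n_def)
  define P where "P = {(z, t). f z \<le> ereal t}"
  define \<psi> where "\<psi> z = n * norm (z - z0) - r" for z
  have "\<exists>l. bounded_linear l \<and> (\<forall>(a, t)\<in>P. \<forall>b. l (a - b) \<le> t + \<psi> b)"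
  proof (rule convex_sandwich)
    show "convex P"
      unfolding P_def by (rule convex_ereal_epigraph[OF conv])
    obtain t where "f z1 \<le> ereal t"
      using proper by (cases "f z1") auto
    then show "P \<noteq> {}" by (auto simp: P_def)
    show "convex_on UNIV \<psi>"
    proof -
      have "convex_on UNIV (\<lambda>z. n * dist z0 z + (- r))"
        using n by (intro convex_on_add convex_on_cmul convex_on_dist) (auto simp: convex_on_const)
      then show ?thesis
        by (simp add: \<psi>_def[abs_def] dist_norm norm_minus_commute)
    qed
    show "0 < (1::real)" by simp
    show "\<psi> b \<le> n - r" if "b \<in> ball z0 1" for b
      using that n mult_left_mono[of "norm (b - z0)" 1 n]
      by (simp add: \<psi>_def dist_norm norm_minus_commute)
    show "0 \<le> t + \<psi> a" if "(a, t) \<in> P" for a t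
    proof (cases "a \<in> ball z0 d")
      case True
      then have "ereal r < ereal t"
        using that by (intro less_le_trans[OF d(2)]) (auto simp: P_def)
      moreover have "0 \<le> n * norm (a - z0)" using n by simp
      ultimately show ?thesis unfolding \<psi>_def by simp
    next
      case False
      then have far: "d \<le> norm (a - z0)" by (simp add: dist_norm norm_minus_commute)
      have "ereal (k a + c) \<le> ereal t"
        using that by (intro order_trans[OF minorant]) (simp add: P_def)
      moreover have "- (norm (a - z0) * K) \<le> k a - k z0"
        using K(2)[of "a - z0"] by (simp add: bounded_linear.linear[OF k] linear_diff abs_le_iff)
      moreover have "r - k z0 - c \<le> m * norm (a - z0)"
        using m(2) mult_left_mono[OF far m(1)] by simp
      ultimately show ?thesis by (simp add: \<psi>_def n_def algebra_simps)
    qed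
  qed
  then obtain l where l: "bounded_linear l" and le: "\<And>a t b. (a, t) \<in> P \<Longrightarrow> l (a - b) \<le> t + \<psi> b"
    by blast
  have "ereal (l (z - z0) + r) \<le> f z" for z
  proof (cases "f z")
    case (real t)
    then show ?thesis using le[of z t z0] by (simp add: P_def \<psi>_def)
  next
    case MInf
    then show ?thesis using minorant[of z] by simp
  qed simp
  then show ?thesis using l by blast
qed

lemma closed_convex_separation:
  fixes D :: "'e::real_normed_vector set"
  assumes D: "closed D" "convex D" "D \<noteq> {}" and x: "x \<notin> D"
  shows "\<exists>l :: 'e \<Rightarrow> real. bounded_linear l \<and> (\<forall>a\<in>D. l a + 1 \<le> l x)"
proof -
  obtain a0 where a0: "a0 \<in> D" using D(3) by blast
  have conv: "convex_ereal (indicator_ereal D)"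
    unfolding convex_ereal_def
  proof (intro allI ballI)
    fix y z and t :: real assume "t \<in> {0<..<1}"
    then show "indicator_ereal D ((1 - t) *\<^sub>R y + t *\<^sub>R z)
        \<le> ereal (1 - t) * indicator_ereal D y + ereal t * indicator_ereal D z"
      using D(2) by (auto simp: indicator_ereal_def convex_alt)
  qed
  have lsc: "lower_semicontinuous (indicator_ereal D)"
  proof (rule lower_semicontinuousI)
    fix r z assume r: "r < indicator_ereal D z"
    show "\<forall>\<^sub>F y in at z. r < indicator_ereal D y"
    proof (cases "z \<in> D")
      case True
      then have "r < 0" using r by (simp add: indicator_ereal_def)
      then show ?thesis by (auto simp: indicator_ereal_def)
    next
      case False
      then have "\<forall>\<^sub>F y in at z. y \<in> - D"
        using D(1) by (intro topological_tendstoD[OF tendsto_ident_at]) auto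
      then show ?thesis
        by eventually_elim (use r False in \<open>auto simp: indicator_ereal_def\<close>)
    qed
  qed
  have "\<exists>l. bounded_linear l \<and> (\<forall>z. ereal (l (z - x) + 1) \<le> indicator_ereal D z)"
    by (rule affine_minorant_above[OF conv lsc _ bounded_linear_zero, of a0 0])
      (use a0 x in \<open>auto simp: indicator_ereal_def\<close>)
  then obtain l where l: "bounded_linear l" "\<And>z. ereal (l (z - x) + 1) \<le> indicator_ereal D z"
    by blast
  have "l a + 1 \<le> l x" if "a \<in> D" for a
    using l(2)[of a] that
    by (simp add: indicator_ereal_def linear_diff[OF bounded_linear.linear[OF l(1)]])
  then show ?thesis using l(1) by blast
qed

text \<open>Sandwich between the number \<open>- norm x\<close> at the single point \<open>x\<close> and the norm, and rescale the
  functional of norm at most one obtained in this way.\<close>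

lemma norming_functional:
  fixes x :: "'e::real_normed_vector"
  shows "\<exists>v :: 'e dual. norm v \<le> norm x \<and> blinfun_apply v x = (norm x)\<^sup>2"
proof -
  have "\<exists>l. bounded_linear l \<and> (\<forall>(a, t)\<in>{(x, - norm x)}. \<forall>b. l (a - b) \<le> t + norm b)"
  proof (rule convex_sandwich)
    show "norm b \<le> 1" if "b \<in> ball 0 1" for b :: 'e
      using that by simp
    show "convex_on UNIV (norm :: 'e \<Rightarrow> real)"
      using convex_on_dist[of UNIV "0 :: 'e"] by simp
  qed auto
  then obtain l where l: "bounded_linear l" and le: "\<And>b. l (x - b) \<le> norm b - norm x"
    by auto
  note lin = bounded_linear.linear[OF l]
  have lx: "l x = - norm x"
    using le[of 0] le[of "2 *\<^sub>R x"] linear_neg[OF lin, of x] norm_scaleR[of 2 x]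
    by (simp add: scaleR_2)
  have "- l b \<le> norm b" for b
    using le[of b] lx linear_diff[OF lin] by simp
  from this[of "- b" for b] this have abs: "norm (l b) \<le> norm b" for b
    using linear_neg[OF lin, of b] by (metis abs_le_iff minus_minus norm_minus_cancel real_norm_def)
  define v where "v = (- norm x) *\<^sub>R Blinfun l"
  have "norm (Blinfun l) \<le> 1"
    by (rule norm_blinfun_bound) (use abs in \<open>auto simp: bounded_linear_Blinfun_apply[OF l]\<close>)
  then have "norm v \<le> norm x"
    using mult_left_mono[of "norm (Blinfun l)" 1 "norm x"] by (simp add: v_def)
  moreover have "blinfun_apply v x = (norm x)\<^sup>2"
    by (simp add: v_def blinfun.scaleR_left blinfun.minus_left bounded_linear_Blinfun_apply[OF l] lx power2_eq_square)
  ultimately show ?thesis by blast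
qed

text \<open>Baire's theorem, applied to the closed sublevel sets at the integers, which cover the space.\<close>

lemma closed_sublevels_bounded_on_ball:
  fixes \<psi> :: "'e::complete_space \<Rightarrow> real"
  assumes closed: "\<And>r. closed {z. \<psi> z \<le> r}"
  shows "\<exists>z0 d M. 0 < d \<and> (\<forall>z\<in>ball z0 d. \<psi> z \<le> M)"
proof -
  let ?S = "\<lambda>n::nat. {z. \<psi> z \<le> real n}"
  have "\<exists>n. interior (?S n) \<noteq> {}"
  proof (rule ccontr)
    assume none: "\<nexists>n. interior (?S n) \<noteq> {}"
    have "euclidean interior_of \<Union>(range ?S) = {}"
    proof (rule Baire_category_alt)
      show "completely_metrizable_space (euclidean::'e topology)
          \<or> locally_compact_space (euclidean::'e topology) \<and> regular_space (euclidean::'e topology)"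
        using completely_metrizable_space_euclidean by blast
    qed (use closed none in auto)
    moreover have "\<Union>(range ?S) = UNIV"
      using real_arch_simple by auto
    ultimately show False by simp
  qed
  then obtain n z0 where "z0 \<in> interior (?S n)" by blast
  then obtain d where "d > 0" "ball z0 d \<subseteq> ?S n"
    by (auto simp: mem_interior)
  then show ?thesis by blast
qed

section \<open>The symmetric pairing on the product of a space and its dual\<close>

text \<open>Transposition identifies the dual of \<open>X \<times> X*\<close> with \<open>X \<times> X*\<close> itself, and duality becomes this
  symmetric bilinear form. Its quadratic form is twice the duality product, so monotonicity says
  that the form is nonnegative on differences.\<close>

definition pairing :: "'a::real_normed_vector \<times> 'a dual \<Rightarrow> 'a \<times> 'a dual \<Rightarrow> real" where
  "pairing z w = blinfun_apply (snd z) (fst w) + blinfun_apply (snd w) (fst z)"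

abbreviation duality_product :: "'a::real_normed_vector \<times> 'a dual \<Rightarrow> real" where
  "duality_product z \<equiv> blinfun_apply (snd z) (fst z)"

lemma abs_pairing_le: "\<bar>pairing z w\<bar> \<le> 2 * (norm z * norm w)"
proof -
  have bound: "\<bar>blinfun_apply (snd a) (fst b)\<bar> \<le> norm a * norm b" for a b :: "'a \<times> 'a dual"
  proof -
    have "\<bar>blinfun_apply (snd a) (fst b)\<bar> \<le> norm (snd a) * norm (fst b)"
      using norm_blinfun[of "snd a" "fst b"] by simp
    also have "\<dots> \<le> norm a * norm b"
      using norm_snd_le[of "snd a" "fst a"] norm_fst_le[of "fst b" "snd b"]
      by (intro mult_mono) auto
    finally show ?thesis .
  qed
  show ?thesis
    using bound[of z w] bound[of w z] mult.commute[of "norm w" "norm z"]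
    unfolding pairing_def by linarith
qed

interpretation pairing: bounded_bilinear pairing
proof
  show "\<exists>K. \<forall>a b. norm (pairing a b) \<le> norm a * norm b * K"
    using abs_pairing_le by (intro exI[of _ 2] allI) (simp add: mult.commute)
qed (simp_all add: pairing_def blinfun.bilinear_simps algebra_simps)

lemma pairing_commute: "pairing z w = pairing w z"
  by (simp add: pairing_def)

lemma pairing_self: "pairing z z = 2 * duality_product z"
  by (simp add: pairing_def)

lemma duality_product_diff: "duality_product (z - w) = duality_product z + duality_product w - pairing z w"
  by (simp add: pairing_def blinfun.bilinear_simps)

lemma reflexive_functional:
  fixes l :: "'a::real_normed_vector \<times> 'a dual \<Rightarrow> real"
  assumes refl: "reflexive TYPE('a)" and l: "bounded_linear l"
  shows "\<exists>y. \<forall>z. l z = pairing z y"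
proof -
  have 1: "bounded_linear (\<lambda>x::'a. l (x, 0))" and 2: "bounded_linear (\<lambda>v::'a dual. l (0, v))"
    by (rule bounded_linear_compose[OF l], simp add: bounded_linear_Pair bounded_linear_ident)+
  obtain x where x: "blinfun.prod_left x = Blinfun (\<lambda>v::'a dual. l (0, v))"
    using refl unfolding reflexive_def by (metis surjD)
  have "l z = pairing z (x, Blinfun (\<lambda>x. l (x, 0)))" for z
  proof -
    have "l (0, snd z) = blinfun_apply (blinfun.prod_left x) (snd z)"
      by (simp add: x bounded_linear_Blinfun_apply[OF 2] del: blinfun.prod_left.rep_eq)
    moreover have "l z = l (fst z, 0) + l (0, snd z)"
      using linear_add[OF bounded_linear.linear[OF l], of "(fst z, 0)" "(0, snd z)"] by simp
    ultimately show ?thesis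
      by (simp add: pairing_def bounded_linear_Blinfun_apply[OF 1])
  qed
  then show ?thesis by blast
qed

text \<open>The vector \<open>x\<close> represents a functional on \<open>X*\<close> that is norming for \<open>v\<close>. That its norm is not larger
  than that of the functional is seen by testing with a functional that is norming for \<open>x\<close>.\<close>

lemma reflexive_norming_vector:
  fixes v :: "'a::real_normed_vector dual"
  assumes refl: "reflexive TYPE('a)"
  shows "\<exists>x. norm x \<le> norm v \<and> blinfun_apply v x = (norm v)\<^sup>2"
proof -
  obtain \<phi> :: "'a dual dual" where \<phi>: "norm \<phi> \<le> norm v" "blinfun_apply \<phi> v = (norm v)\<^sup>2"
    using norming_functional by blast
  obtain x :: 'a where x: "\<phi> = blinfun.prod_left x"
    using refl unfolding reflexive_def by (metis surjD)
  obtain w :: "'a dual" where w: "norm w \<le> norm x" "blinfun_apply w x = (norm x)\<^sup>2"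
    using norming_functional by blast
  have "norm x * norm x = blinfun_apply \<phi> w"
    using w x by (simp add: power2_eq_square)
  also have "\<dots> \<le> norm \<phi> * norm w"
    using norm_blinfun[of \<phi> w] by simp
  also have "\<dots> \<le> norm v * norm x"
    using \<phi> w by (intro mult_mono) auto
  finally have "norm x \<le> norm v"
    by (cases "x = 0") auto
  moreover have "blinfun_apply v x = (norm v)\<^sup>2"
    using \<phi>(2) x by simp
  ultimately show ?thesis by blast
qed

section \<open>Conjugates in transposed form\<close>

abbreviation tconj :: "('a::real_normed_vector \<times> 'a dual \<Rightarrow> ereal) \<Rightarrow> 'a \<times> 'a dual \<Rightarrow> ereal" where
  "tconj f \<equiv> swap_args (conjugate f)"

lemma ereal_leI_upper: "(\<And>r. y \<le> ereal r \<Longrightarrow> x \<le> ereal r) \<Longrightarrow> x \<le> y"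
  by (rule ereal_le_real) blast

text \<open>Conjugates are handled through their real upper bounds; no arithmetic with infinite values is
  then needed.\<close>

lemma tconj_le_iff:
  "tconj f y \<le> ereal r \<longleftrightarrow> (\<forall>z a. f z \<le> ereal a \<longrightarrow> pairing z y - a \<le> r)"
proof -
  obtain x v where y: "y = (x, v)" by (cases y)
  have "ereal (pairing z y) - f z \<le> ereal r \<longleftrightarrow> (\<forall>a. f z \<le> ereal a \<longrightarrow> pairing z y - a \<le> r)" for z
  proof (cases "f z")
    case (real t)
    then show ?thesis by (auto simp: algebra_simps)
  next
    case MInf
    have "\<not> pairing z y - (pairing z y - r - 1) \<le> r" by simp
    then have "\<not> (\<forall>a. pairing z y - a \<le> r)" by blast
    then show ?thesis using MInf by simp
  qed simp
  moreover have "tconj f y = (SUP z. ereal (pairing z y) - f z)"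
    unfolding y swap_args_def conjugate_def pairing_def
    by (auto simp: case_prod_beta intro: SUP_cong)
  ultimately show ?thesis by (simp add: SUP_le_iff)
qed

lemma tconj_antimono:
  assumes "\<And>z. f z \<le> g z" shows "tconj g y \<le> tconj f y"
proof (rule ereal_leI_upper)
  fix r assume "tconj f y \<le> ereal r"
  then show "tconj g y \<le> ereal r"
    unfolding tconj_le_iff using order_trans[OF assms] by blast
qed

lemma convex_tconj_epigraph:
  fixes f :: "'a::real_normed_vector \<times> 'a dual \<Rightarrow> ereal"
  shows "convex {(y, r). tconj f y \<le> ereal r}"
proof -
  have "{(y, r). tconj f y \<le> ereal r}
      = (\<Inter>(z, a)\<in>{(z, a). f z \<le> ereal a}. {(y, r). pairing z y - a \<le> r})"
    by (auto simp: tconj_le_iff)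
  moreover have "convex {(y, r). pairing z y - a \<le> r}" for z :: "'a \<times> 'a dual" and a
    unfolding convex_alt
  proof (intro ballI allI impI)
    fix p q :: "('a \<times> 'a dual) \<times> real" and u :: real
    assume p: "p \<in> {(y, r). pairing z y - a \<le> r}" and q: "q \<in> {(y, r). pairing z y - a \<le> r}"
      and u: "0 \<le> u \<and> u \<le> 1"
    have "(1 - u) * (pairing z (fst p) - a) + u * (pairing z (fst q) - a) \<le> (1 - u) * snd p + u * snd q"
      using p q u by (intro add_mono mult_left_mono) auto
    then show "(1 - u) *\<^sub>R p + u *\<^sub>R q \<in> {(y, r). pairing z y - a \<le> r}"
      by (simp add: case_prod_beta pairing.add_right pairing.scaleR_right) (simp add: algebra_simps)
  qed
  ultimately show ?thesis by (auto intro!: convex_INT)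
qed

lemma tconj_proper:
  assumes "f z \<le> ereal t" shows "tconj f y \<noteq> - \<infinity>"
proof
  assume "tconj f y = - \<infinity>"
  then have "tconj f y \<le> ereal (pairing z y - t - 1)" by simp
  then have "pairing z y - t \<le> pairing z y - t - 1"
    using assms unfolding tconj_le_iff by blast
  then show False by simp
qed

text \<open>The Fenchel-Moreau theorem; reflexivity turns the continuous affine minorant of \<open>f\<close> into a
  point of \<open>X \<times> X*\<close>.\<close>

lemma biconjugate_le:
  fixes f :: "'a::real_normed_vector \<times> 'a dual \<Rightarrow> ereal"
  assumes refl: "reflexive TYPE('a)" and conv: "convex_ereal f" and lsc: "lower_semicontinuous f"
    and proper: "f z1 \<le> ereal t1" and minorant: "\<And>z. ereal (pairing z w - c) \<le> f z"
  shows "f z \<le> tconj (tconj f) z"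
proof (rule ereal_leI_upper, rule ccontr)
  fix r assume r: "tconj (tconj f) z \<le> ereal r" and "\<not> f z \<le> ereal r"
  then have "ereal r < f z" by simp
  then obtain r' where r': "ereal r < ereal r'" "ereal r' < f z"
    using ereal_dense2 by blast
  have "\<exists>l. bounded_linear l \<and> (\<forall>y. ereal (l (y - z) + r') \<le> f y)"
  proof (rule affine_minorant_above[OF conv lsc _ pairing.bounded_linear_left _ r'(2)])
    show "f z1 < \<infinity>" using proper by auto
    show "ereal (pairing y w + - c) \<le> f y" for y using minorant[of y] by simp
  qed
  then obtain l where l: "bounded_linear l" "\<And>y. ereal (l (y - z) + r') \<le> f y" by blast
  obtain p where p: "\<And>y. l y = pairing y p"
    using reflexive_functional[OF refl l(1)] by blast
  have "pairing y p - a \<le> pairing z p - r'" if "f y \<le> ereal a" for y a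
    using order_trans[OF l(2)[of y] that] by (simp add: p pairing.diff_left)
  then have "tconj f p \<le> ereal (pairing z p - r')"
    unfolding tconj_le_iff by blast
  then have "pairing p z - (pairing z p - r') \<le> r"
    using r unfolding tconj_le_iff[of "tconj f"] by blast
  then show False using r'(1) by (simp add: pairing_commute)
qed

lemma self_dual_kernel_le_iff:
  assumes "self_dual_kernel \<psi>"
  shows "\<psi> z \<le> r \<longleftrightarrow> (\<forall>w. pairing w z - \<psi> w \<le> r)"
proof -
  have "ereal (\<psi> z) = tconj (\<lambda>z. ereal (\<psi> z)) z"
    using assms unfolding self_dual_kernel_def by (metis (no_types))
  then have "ereal (\<psi> z) \<le> ereal r \<longleftrightarrow> (\<forall>w a. \<psi> w \<le> a \<longrightarrow> pairing w z - a \<le> r)"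
    by (simp add: tconj_le_iff)
  also have "\<dots> \<longleftrightarrow> (\<forall>w. pairing w z - \<psi> w \<le> r)"
    by (metis diff_left_mono order.refl order_trans)
  finally show ?thesis by simp
qed

lemma self_dual_kernel_zero:
  assumes "self_dual_kernel \<psi>" shows "\<psi> 0 = 0"
proof -
  have nonneg: "0 \<le> \<psi> w" for w using assms unfolding self_dual_kernel_def by blast
  have "\<psi> 0 \<le> 0"
    unfolding self_dual_kernel_le_iff[OF assms] using nonneg by (simp add: pairing.zero_right)
  then show ?thesis using nonneg[of 0] by simp
qed

lemma self_dual_kernel_convex:
  assumes "self_dual_kernel \<psi>" shows "convex_on UNIV \<psi>"
proof (rule convex_onI)
  fix t :: real and x y assume t: "0 < t" "t < 1"
  note le = self_dual_kernel_le_iff[OF assms]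
  show "\<psi> ((1 - t) *\<^sub>R x + t *\<^sub>R y) \<le> (1 - t) * \<psi> x + t * \<psi> y"
    unfolding le
  proof
    fix w
    have "pairing w x - \<psi> w \<le> \<psi> x" "pairing w y - \<psi> w \<le> \<psi> y"
      using le by blast+
    then have "(1 - t) * (pairing w x - \<psi> w) + t * (pairing w y - \<psi> w) \<le> (1 - t) * \<psi> x + t * \<psi> y"
      using t by (intro add_mono mult_left_mono) auto
    then show "pairing w ((1 - t) *\<^sub>R x + t *\<^sub>R y) - \<psi> w \<le> (1 - t) * \<psi> x + t * \<psi> y"
      by (simp add: pairing.add_right pairing.scaleR_right) (simp add: algebra_simps)
  qed
qed simp

lemma self_dual_kernel_bounded_on_ball:
  fixes \<psi> :: "'a::banach \<times> 'a dual \<Rightarrow> real"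
  assumes "self_dual_kernel \<psi>"
  shows "\<exists>z0 d M. 0 < d \<and> (\<forall>z\<in>ball z0 d. \<psi> z \<le> M)"
proof (rule closed_sublevels_bounded_on_ball)
  fix r
  have "{z. \<psi> z \<le> r} = (\<Inter>w. {z. pairing w z - \<psi> w \<le> r})"
    by (auto simp: self_dual_kernel_le_iff[OF assms, of _ r])
  then show "closed {z. \<psi> z \<le> r}"
    by (auto intro!: closed_INT closed_Collect_le continuous_intros pairing.continuous_on)
qed

section \<open>The self-dual function generated by a function and its conjugate\<close>

lemma half_sum_le_iff:
  fixes a b :: ereal
  assumes "a \<noteq> - \<infinity>" "b \<noteq> - \<infinity>"
  shows "ereal (1/2) * a + ereal (1/2) * b + ereal c \<le> ereal r
    \<longleftrightarrow> (\<exists>s t. a \<le> ereal s \<and> b \<le> ereal t \<and> s / 2 + t / 2 + c \<le> r)"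
proof (cases a; cases b)
  fix s t assume st: "a = ereal s" "b = ereal t"
  show ?thesis
  proof
    assume "ereal (1/2) * a + ereal (1/2) * b + ereal c \<le> ereal r"
    then show "\<exists>s t. a \<le> ereal s \<and> b \<le> ereal t \<and> s / 2 + t / 2 + c \<le> r"
      using st by (intro exI[of _ s] exI[of _ t]) simp
  qed (use st in auto)
qed (use assms in auto)

lemma ereal_geI_upper: "(\<And>t. e \<le> ereal t \<Longrightarrow> x \<le> t) \<Longrightarrow> ereal x \<le> e"
  by (rule ereal_le_real) auto

text \<open>The function \<open>f\<close> is paired with its transposed conjugate. Its properness enters through a point
  of finiteness and a continuous affine minorant, whose slope \<open>w\<close> is then a point of finiteness of
  the conjugate.\<close>

locale conjugate_pair =
  fixes f :: "'a::banach \<times> 'a dual \<Rightarrow> ereal" and \<psi> :: "'a \<times> 'a dual \<Rightarrow> real"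
    and z\<^sub>0 w :: "'a \<times> 'a dual" and t\<^sub>0 c :: real
  assumes reflexivity: "reflexive TYPE('a)" and kernel: "self_dual_kernel \<psi>"
    and conv: "convex_ereal f" and lsc: "lower_semicontinuous f"
    and finite_at: "f z\<^sub>0 \<le> ereal t\<^sub>0" and minorant: "\<And>z. ereal (pairing z w - c) \<le> f z"
begin

lemma f_proper: "f z \<noteq> - \<infinity>"
  using minorant[of z] by auto

lemma R_cost_le_iff:
  "R_cost \<psi> f y1 y2 \<le> ereal r
    \<longleftrightarrow> (\<exists>s t. f y1 \<le> ereal s \<and> tconj f y2 \<le> ereal t \<and> s / 2 + t / 2 + \<psi> (y1 - y2) / 4 \<le> r)"
proof -
  have "R_cost \<psi> f y1 y2
      = ereal (1/2) * f y1 + ereal (1/2) * tconj f y2 + ereal (\<psi> (y1 - y2) / 4)"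
    by (cases y1; cases y2) (simp add: R_cost_def swap_args_def)
  then show ?thesis
    using half_sum_le_iff[OF f_proper tconj_proper[where f = f, OF finite_at]] by simp
qed

lemma R_fun_le_R_cost: "z = (1/2) *\<^sub>R (y1 + y2) \<Longrightarrow> R_fun \<psi> f z \<le> R_cost \<psi> f y1 y2"
  unfolding R_fun_def by (rule INF_lower2[of "(y1, y2)"]) auto

lemma R_fun_greatest:
  "(\<And>y1 y2. z = (1/2) *\<^sub>R (y1 + y2) \<Longrightarrow> b \<le> R_cost \<psi> f y1 y2) \<Longrightarrow> b \<le> R_fun \<psi> f z"
  unfolding R_fun_def by (rule INF_greatest) auto

text \<open>Add the Fenchel-Young inequalities for \<open>(z1, y2)\<close>, for \<open>(y1, z2)\<close> and, with the kernel,
  for \<open>(z1 - z2, y1 - y2)\<close>: the mixed terms combine to the pairing of the midpoints.\<close>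

lemma R_cost_Fenchel_Young:
  assumes r: "R_cost \<psi> f z1 z2 \<le> ereal r" and s: "R_cost \<psi> f y1 y2 \<le> ereal s"
  shows "pairing ((1/2) *\<^sub>R (z1 + z2)) ((1/2) *\<^sub>R (y1 + y2)) \<le> r + s"
proof -
  obtain a b where ab: "f z1 \<le> ereal a" "tconj f z2 \<le> ereal b" "a / 2 + b / 2 + \<psi> (z1 - z2) / 4 \<le> r"
    using r unfolding R_cost_le_iff by blast
  obtain a' b' where ab': "f y1 \<le> ereal a'" "tconj f y2 \<le> ereal b'"
      "a' / 2 + b' / 2 + \<psi> (y1 - y2) / 4 \<le> s"
    using s unfolding R_cost_le_iff by blast
  have "pairing z1 y2 - a \<le> b'" "pairing y1 z2 - a' \<le> b"
    using ab(1,2) ab'(1,2) unfolding tconj_le_iff by blast+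
  moreover have "pairing (z1 - z2) (y1 - y2) - \<psi> (z1 - z2) \<le> \<psi> (y1 - y2)"
    using self_dual_kernel_le_iff[OF kernel] by blast
  moreover have "pairing ((1/2) *\<^sub>R (z1 + z2)) ((1/2) *\<^sub>R (y1 + y2))
      = pairing z1 y2 / 2 + pairing y1 z2 / 2 + pairing (z1 - z2) (y1 - y2) / 4"
    using pairing_commute[of y1 z2]
    by (simp add: pairing.add_left pairing.add_right pairing.diff_left pairing.diff_right
        pairing.scaleR_left pairing.scaleR_right field_simps)
  ultimately show ?thesis using ab(3) ab'(3) by linarith
qed

lemma R_fun_Fenchel_Young:
  assumes r: "R_fun \<psi> f z \<le> ereal r" and s: "R_fun \<psi> f y \<le> ereal s"
  shows "pairing z y \<le> r + s"
proof -
  have cost: "ereal (pairing z' y' - t) \<le> R_fun \<psi> f z'"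
    if y: "y' = (1/2) *\<^sub>R (y1 + y2)" "R_cost \<psi> f y1 y2 \<le> ereal t" for z' y' y1 y2 t
  proof (rule R_fun_greatest, rule ereal_geI_upper)
    fix x1 x2 u assume "z' = (1/2) *\<^sub>R (x1 + x2)" "R_cost \<psi> f x1 x2 \<le> ereal u"
    then show "pairing z' y' - t \<le> u"
      using R_cost_Fenchel_Young[of x1 x2 u y1 y2 t] y by simp
  qed
  have "ereal (pairing z y - r) \<le> R_fun \<psi> f y"
  proof (rule R_fun_greatest, rule ereal_geI_upper)
    fix y1 y2 t assume "y = (1/2) *\<^sub>R (y1 + y2)" "R_cost \<psi> f y1 y2 \<le> ereal t"
    then have "ereal (pairing z y - t) \<le> R_fun \<psi> f z" by (rule cost)
    then have "ereal (pairing z y - t) \<le> ereal r" using r by (rule order_trans)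
    then show "pairing z y - r \<le> t" by simp
  qed
  then have "ereal (pairing z y - r) \<le> ereal s" using s by (rule order_trans)
  then show ?thesis by simp
qed

text \<open>Strong duality. Regard the difference \<open>y1 - y2\<close> as perturbation and sandwich between the kernel,
  which is finite everywhere, and the rest. The multiplier \<open>p\<close> found in this way determines the
  point \<open>(z - 2 p, z + 2 p)\<close>; taking suprema over \<open>y1\<close>, \<open>y2\<close> and \<open>b\<close> separately turns the
  inequality into an estimate for the cost there, because \<open>f\<close> is its own biconjugate and \<open>\<psi>\<close> its
  own conjugate.\<close>

lemma R_cost_attains_conjugate:
  assumes s: "tconj (R_fun \<psi> f) z \<le> ereal s"
  shows "\<exists>y1 y2. z = (1/2) *\<^sub>R (y1 + y2) \<and> R_cost \<psi> f y1 y2 \<le> ereal s"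
proof -
  define T :: "(('a \<times> 'a dual) \<times> real) \<times> (('a \<times> 'a dual) \<times> real) \<Rightarrow> ('a \<times> 'a dual) \<times> real" where
    "T = (\<lambda>q. (fst (fst q) - fst (snd q),
      snd (fst q) / 2 + snd (snd q) / 2 - pairing (fst (fst q) + fst (snd q)) z / 2))"
  define P where "P = T ` ({(y, a). f y \<le> ereal a} \<times> {(y, b). tconj f y \<le> ereal b})"
  define \<phi> where "\<phi> b = (1/4) * \<psi> b + s" for b
  have mem_P: "(y1 - y2, a / 2 + b / 2 - pairing (y1 + y2) z / 2) \<in> P"
    if "f y1 \<le> ereal a" "tconj f y2 \<le> ereal b" for y1 y2 a b
    unfolding P_def using that by (intro image_eqI[of _ _ "((y1, a), (y2, b))"]) (auto simp: T_def)
  have "linear T"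
  proof (rule linearI)
    fix q q' and t :: real
    show "T (q + q') = T q + T q'"
      by (simp add: T_def pairing.add_left add_divide_distrib)
    show "T (t *\<^sub>R q) = t *\<^sub>R T q"
      by (simp add: T_def pairing.scaleR_left pairing.add_left scaleR_diff_right) (simp add: algebra_simps)
  qed
  then have P_convex: "convex P"
    unfolding P_def using convex_ereal_epigraph[OF conv] convex_tconj_epigraph[of f]
    by (intro convex_linear_image convex_Times)
  have "tconj f w \<le> ereal c"
    unfolding tconj_le_iff using minorant order_trans by fastforce
  then have P_ne: "P \<noteq> {}" using mem_P[OF finite_at] by blast
  have nonneg: "0 \<le> r + \<phi> a" if "(a, r) \<in> P" for a r
  proof -
    obtain q where q: "q \<in> {(y, a). f y \<le> ereal a} \<times> {(y, b). tconj f y \<le> ereal b}" "(a, r) = T q"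
      using \<open>(a, r) \<in> P\<close> unfolding P_def by blast
    define y1 y2 b b' where "y1 = fst (fst q)" and "y2 = fst (snd q)"
      and "b = snd (fst q)" and "b' = snd (snd q)"
    note q_parts = this
    have y: "f y1 \<le> ereal b" "tconj f y2 \<le> ereal b'" "a = y1 - y2"
        "r = b / 2 + b' / 2 - pairing (y1 + y2) z / 2"
      using q unfolding T_def q_parts by (auto simp: mem_Times_iff case_prod_beta)
    have "R_cost \<psi> f y1 y2 \<le> ereal (b / 2 + b' / 2 + \<psi> (y1 - y2) / 4)"
      unfolding R_cost_le_iff using y(1,2) by blast
    then have "R_fun \<psi> f ((1/2) *\<^sub>R (y1 + y2)) \<le> ereal (b / 2 + b' / 2 + \<psi> (y1 - y2) / 4)"
      by (rule order_trans[OF R_fun_le_R_cost[OF refl]])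
    then have "pairing ((1/2) *\<^sub>R (y1 + y2)) z - (b / 2 + b' / 2 + \<psi> (y1 - y2) / 4) \<le> s"
      using s unfolding tconj_le_iff by blast
    then show ?thesis
      using y(3,4) by (simp add: \<phi>_def pairing.scaleR_left)
  qed
  obtain b0 d M where M: "0 < d" "\<And>b. b \<in> ball b0 d \<Longrightarrow> \<psi> b \<le> M"
    using self_dual_kernel_bounded_on_ball[OF kernel] by blast
  have "\<exists>l. bounded_linear l \<and> (\<forall>(a, r)\<in>P. \<forall>b. l (a - b) \<le> r + \<phi> b)"
  proof (rule convex_sandwich[OF P_convex P_ne _ M(1) _ nonneg])
    show "convex_on UNIV \<phi>"
      unfolding \<phi>_def[abs_def] using self_dual_kernel_convex[OF kernel]
      by (intro convex_on_add convex_on_cmul) (auto simp: convex_on_const)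
    show "\<phi> b \<le> (1/4) * M + s" if "b \<in> ball b0 d" for b
      using M(2)[OF that] by (simp add: \<phi>_def)
  qed
  then obtain l where l: "bounded_linear l" "\<And>a r b. (a, r) \<in> P \<Longrightarrow> l (a - b) \<le> r + \<phi> b"
    by blast
  obtain p where p: "\<And>z. l z = pairing z p"
    using reflexive_functional[OF reflexivity l(1)] by blast
  \<comment> \<open>From here the suprema are taken one at a time: over \<open>y1\<close> in \<open>conj_le\<close>, over \<open>y2\<close> for \<open>f_le\<close>, over
    \<open>b\<close> for the kernel. Finiteness of the first two values makes the rearrangements legitimate.\<close>
  have main: "pairing y1 (z + 2 *\<^sub>R p) - a
      \<le> b' - pairing y2 (z - 2 *\<^sub>R p) + 2 * pairing b p + \<psi> b / 2 + 2 * s"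
    if "f y1 \<le> ereal a" "tconj f y2 \<le> ereal b'" for y1 y2 a b b'
    using l(2)[OF mem_P[OF that], of b]
    unfolding p \<phi>_def pairing.add_left pairing.add_right pairing.diff_left pairing.diff_right
      pairing.scaleR_right real_scaleR_def
    by argo
  have conj_le: "tconj f (z + 2 *\<^sub>R p)
      \<le> ereal (b' - pairing y2 (z - 2 *\<^sub>R p) + 2 * pairing b p + \<psi> b / 2 + 2 * s)"
    if "tconj f y2 \<le> ereal b'" for y2 b b'
    unfolding tconj_le_iff using main that by blast
  obtain \<alpha> where \<alpha>: "tconj f (z + 2 *\<^sub>R p) = ereal \<alpha>"
    using conj_le[OF \<open>tconj f w \<le> ereal c\<close>, of 0] tconj_proper[where f = f, OF finite_at, of "z + 2 *\<^sub>R p"]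
    by (cases "tconj f (z + 2 *\<^sub>R p)") auto
  have "tconj (tconj f) (z - 2 *\<^sub>R p) \<le> ereal (2 * pairing b p + \<psi> b / 2 + 2 * s - \<alpha>)" for b
    unfolding tconj_le_iff[of "tconj f"] using conj_le[of _ _ b] \<alpha> by fastforce
  then have f_le: "f (z - 2 *\<^sub>R p) \<le> ereal (2 * pairing b p + \<psi> b / 2 + 2 * s - \<alpha>)" for b
    by (rule order_trans[OF biconjugate_le
        [OF reflexivity conv lsc finite_at minorant]])
  obtain \<beta> where \<beta>: "f (z - 2 *\<^sub>R p) = ereal \<beta>"
    using f_le[of 0] f_proper[of "z - 2 *\<^sub>R p"] by (cases "f (z - 2 *\<^sub>R p)") auto
  have "\<psi> (- 4 *\<^sub>R p) \<le> 4 * s - 2 * \<alpha> - 2 * \<beta>"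
    unfolding self_dual_kernel_le_iff[OF kernel, of "- 4 *\<^sub>R p"]
  proof
    fix b
    show "pairing b (- 4 *\<^sub>R p) - \<psi> b \<le> 4 * s - 2 * \<alpha> - 2 * \<beta>"
      using f_le[of b] \<beta> by (simp add: pairing.scaleR_right pairing.minus_right)
  qed
  moreover have "(z - 2 *\<^sub>R p) - (z + 2 *\<^sub>R p) = - 4 *\<^sub>R p"
    using scaleR_left_distrib[of "- 2" "- 2" p] by simp
  ultimately have "R_cost \<psi> f (z - 2 *\<^sub>R p) (z + 2 *\<^sub>R p) \<le> ereal s"
    unfolding R_cost_le_iff using \<alpha> \<beta> by (intro exI[of _ \<beta>] exI[of _ \<alpha>]) auto
  moreover have "z = (1/2) *\<^sub>R ((z - 2 *\<^sub>R p) + (z + 2 *\<^sub>R p))"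
    by (simp flip: scaleR_2)
  ultimately show ?thesis by blast
qed

theorem R_fun_self_dual: "tconj (R_fun \<psi> f) = R_fun \<psi> f"
proof (rule ext, rule antisym)
  fix z
  show "tconj (R_fun \<psi> f) z \<le> R_fun \<psi> f z"
  proof (rule ereal_leI_upper)
    fix r assume "R_fun \<psi> f z \<le> ereal r"
    then show "tconj (R_fun \<psi> f) z \<le> ereal r"
      unfolding tconj_le_iff using R_fun_Fenchel_Young by (auto simp: algebra_simps)
  qed
  show "R_fun \<psi> f z \<le> tconj (R_fun \<psi> f) z"
  proof (rule ereal_leI_upper)
    fix r assume "tconj (R_fun \<psi> f) z \<le> ereal r"
    then show "R_fun \<psi> f z \<le> ereal r"
      using R_cost_attains_conjugate R_fun_le_R_cost order_trans by blast
  qed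
qed

lemma duality_product_le_R_fun: "ereal (duality_product z) \<le> R_fun \<psi> f z"
proof (rule ereal_geI_upper)
  fix t assume t: "R_fun \<psi> f z \<le> ereal t"
  show "duality_product z \<le> t"
    using R_fun_Fenchel_Young[OF t t] by (simp add: pairing_self)
qed

theorem R_fun_attained: "\<exists>y1 y2. z = (1/2) *\<^sub>R (y1 + y2) \<and> R_fun \<psi> f z = R_cost \<psi> f y1 y2"
proof (cases "R_fun \<psi> f z")
  case (real s)
  then have "tconj (R_fun \<psi> f) z \<le> ereal s"
    by (simp add: R_fun_self_dual)
  then obtain y1 y2 where y: "z = (1/2) *\<^sub>R (y1 + y2)" "R_cost \<psi> f y1 y2 \<le> ereal s"
    using R_cost_attains_conjugate by blast
  then show ?thesis
    using R_fun_le_R_cost[OF y(1)] real by (metis antisym)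
next
  case PInf
  have z: "z = (1/2) *\<^sub>R (z + z)" by (simp flip: scaleR_2)
  then show ?thesis using R_fun_le_R_cost[OF z] PInf by (metis ereal_infty_less_eq(1))
next
  case MInf
  then show ?thesis using duality_product_le_R_fun[of z] by simp
qed

end

section \<open>Self-dual functions represent maximal monotone operators\<close>

definition square_kernel :: "'a::real_normed_vector \<times> 'a dual \<Rightarrow> real" where
  "square_kernel z = ((norm (fst z))\<^sup>2 + (norm (snd z))\<^sup>2) / 2"

lemma square_kernel_ge: "- duality_product z \<le> square_kernel z"
proof -
  have "- duality_product z \<le> norm (snd z) * norm (fst z)"
    using norm_blinfun[of "snd z" "fst z"] by simp
  also have "\<dots> \<le> square_kernel z"
    using sum_squares_bound[of "norm (snd z)" "norm (fst z)"] by (simp add: square_kernel_def)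
  finally show ?thesis .
qed

lemma square_kernel_zero: "square_kernel z \<le> 0 \<Longrightarrow> z = 0"
  by (simp add: square_kernel_def prod_eq_iff sum_power2_le_zero_iff)

lemma convex_on_norm_square:
  "convex_on UNIV (\<lambda>z::'e::real_normed_vector. (norm z)\<^sup>2)"
proof (rule convex_onI)
  fix t :: real and x y :: 'e assume t: "0 < t" "t < 1"
  have "norm ((1 - t) *\<^sub>R x + t *\<^sub>R y) \<le> (1 - t) * norm x + t * norm y"
    by (rule norm_triangle_le) (use t in simp)
  then have "(norm ((1 - t) *\<^sub>R x + t *\<^sub>R y))\<^sup>2 \<le> ((1 - t) * norm x + t * norm y)\<^sup>2"
    by (rule power_mono) simp
  also have "\<dots> \<le> (1 - t) * (norm x)\<^sup>2 + t * (norm y)\<^sup>2"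
    using convex_onD[OF convex_power2, of t "norm x" "norm y"] t by simp
  finally show "(norm ((1 - t) *\<^sub>R x + t *\<^sub>R y))\<^sup>2 \<le> (1 - t) * (norm x)\<^sup>2 + t * (norm y)\<^sup>2" .
qed simp

lemma square_kernel_convex: "convex_on UNIV (\<lambda>z. square_kernel (z - z0))"
proof (rule convex_onI)
  fix t :: real and x y :: "'a \<times> 'a dual" assume t: "0 < t" "t < 1"
  define u v where "u = x - z0" and "v = y - z0"
  have "((1 - t) *\<^sub>R x + t *\<^sub>R y) - z0 = (1 - t) *\<^sub>R u + t *\<^sub>R v"
    by (simp add: u_def v_def algebra_simps)
  moreover have "(norm ((1 - t) *\<^sub>R fst u + t *\<^sub>R fst v))\<^sup>2
      \<le> (1 - t) * (norm (fst u))\<^sup>2 + t * (norm (fst v))\<^sup>2"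
    "(norm ((1 - t) *\<^sub>R snd u + t *\<^sub>R snd v))\<^sup>2
      \<le> (1 - t) * (norm (snd u))\<^sup>2 + t * (norm (snd v))\<^sup>2"
    using t by (intro convex_onD[OF convex_on_norm_square]; simp)+
  moreover have "(p + q) / 2 \<le> (1 - t) * ((a + c) / 2) + t * ((b + d) / 2)"
    if "p \<le> (1 - t) * a + t * b" "q \<le> (1 - t) * c + t * d" for p q a b c d :: real
    using add_mono[OF that] by (simp add: field_simps)
  ultimately show "square_kernel (((1 - t) *\<^sub>R x + t *\<^sub>R y) - z0)
      \<le> (1 - t) * square_kernel (x - z0) + t * square_kernel (y - z0)"
    by (simp only: u_def[symmetric] v_def[symmetric] square_kernel_def fst_add snd_add fst_scaleR snd_scaleR)
qed simp

text \<open>The square kernel is at most its own transposed conjugate; the supremum is attained because the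
  two components of \<open>z\<close> have norming partners.\<close>

lemma square_kernel_conjugate_attained:
  fixes z :: "'a::real_normed_vector \<times> 'a dual"
  assumes "reflexive TYPE('a)"
  shows "\<exists>p. pairing p z + square_kernel p \<le> - square_kernel z"
proof -
  obtain v :: "'a dual" where v: "norm v \<le> norm (fst z)" "blinfun_apply v (fst z) = (norm (fst z))\<^sup>2"
    using norming_functional by blast
  obtain x where x: "norm x \<le> norm (snd z)" "blinfun_apply (snd z) x = (norm (snd z))\<^sup>2"
    using reflexive_norming_vector[OF assms] by blast
  have "(norm v)\<^sup>2 \<le> (norm (fst z))\<^sup>2" "(norm x)\<^sup>2 \<le> (norm (snd z))\<^sup>2"
    using v(1) x(1) by (simp_all add: power_mono)
  moreover have "pairing (- x, - v) z = - (norm (fst z))\<^sup>2 - (norm (snd z))\<^sup>2"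
    using v(2) x(2) by (simp add: pairing_def blinfun.minus_left blinfun.minus_right)
  moreover have "square_kernel (- x, - v) = ((norm x)\<^sup>2 + (norm v)\<^sup>2) / 2"
    by (simp add: square_kernel_def)
  ultimately have "pairing (- x, - v) z + square_kernel (- x, - v) \<le> - square_kernel z"
    unfolding square_kernel_def by argo
  then show ?thesis by blast
qed

lemma monotone_operator_iff:
  "monotone_operator A \<longleftrightarrow> (\<forall>z\<in>A. \<forall>y\<in>A. 0 \<le> duality_product (z - y))"
  by (simp add: monotone_operator_def case_prod_beta)

text \<open>Self-duality makes the contact set monotone: for two of its points the Fenchel-Young inequality
  is exactly the monotonicity inequality.

  For maximality let \<open>z0\<close> be monotonically related to the contact set. After translation by \<open>z0\<close> the
  function \<open>R\<close> still lies above the duality product, and half the squared norm lies above the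
  negative of the duality product, so that their sum is nonnegative. Sandwiching yields a dual point \<open>y\<close>, and as both functions are
  self-dual the dual inequality at \<open>y\<close> is the reverse of the primal one. All the estimates are
  therefore equalities: \<open>y\<close> lies in the contact set and the duality product of \<open>y - z0\<close> is minus half
  its squared norm, whence \<open>y = z0\<close> by monotonicity.

  The last step needs a kernel that vanishes only at the origin, which is why half the squared norm
  is used: a general self-dual kernel, such as \<open>h (norm x) + h* (norm v)\<close> with
  \<open>h s = (max 0 (s - 1))^2 / 2\<close>, may have other zeros.\<close>

theorem self_dual_representative_maximal_monotone:
  fixes R :: "'a::real_normed_vector \<times> 'a dual \<Rightarrow> ereal"
  assumes refl: "reflexive TYPE('a)" and self_dual: "tconj R = R"
    and proper: "R z1 \<le> ereal t1" and ge: "\<And>z. ereal (duality_product z) \<le> R z"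
  shows "maximal_monotone_operator {z. R z = ereal (duality_product z)}" (is "maximal_monotone_operator ?A")
proof -
  have R_le_iff: "R y \<le> ereal r \<longleftrightarrow> (\<forall>z a. R z \<le> ereal a \<longrightarrow> pairing z y - a \<le> r)" for y r
    using tconj_le_iff[of R] unfolding self_dual .
  have "monotone_operator ?A"
    unfolding monotone_operator_iff
  proof (intro ballI)
    fix z y assume "z \<in> ?A" "y \<in> ?A"
    then have "R z \<le> ereal (duality_product z)" "R y \<le> ereal (duality_product y)" by auto
    then have "pairing z y - duality_product z \<le> duality_product y"
      unfolding R_le_iff[of y] by blast
    then show "0 \<le> duality_product (z - y)"
      by (simp only: duality_product_diff)
  qed
  moreover have "z0 \<in> ?A" if B: "monotone_operator B" "?A \<subseteq> B" "z0 \<in> B" for B z0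
  proof -
    define P where "P = {(z, r). R z \<le> ereal r}"
    define \<psi> where "\<psi> b = square_kernel (b - z0) + (duality_product z0 - pairing z0 b)" for b
    have "\<exists>l. bounded_linear l \<and> (\<forall>(a, r)\<in>P. \<forall>b. l (a - b) \<le> r + \<psi> b)"
    proof (rule convex_sandwich)
      show "convex P"
        unfolding P_def using convex_tconj_epigraph[of R] self_dual by simp
      show "P \<noteq> {}" unfolding P_def using proper by blast
      have "convex_on UNIV (\<lambda>b. duality_product z0 - pairing z0 b)"
      proof (rule convex_onI)
        fix t :: real and x y :: "'a \<times> 'a dual"
        show "duality_product z0 - pairing z0 ((1 - t) *\<^sub>R x + t *\<^sub>R y)
            \<le> (1 - t) * (duality_product z0 - pairing z0 x) + t * (duality_product z0 - pairing z0 y)"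
          unfolding pairing.add_right pairing.scaleR_right by (simp add: algebra_simps)
      qed simp
      then show "convex_on UNIV \<psi>"
        unfolding \<psi>_def[abs_def] by (intro convex_on_add square_kernel_convex)
      show "0 < (1::real)" by simp
      show "\<psi> b \<le> 1 + duality_product z0 + 2 * (norm z0 * (norm z0 + 1))" if "b \<in> ball z0 1" for b
      proof -
        have b: "norm (b - z0) \<le> 1" using that by (simp add: dist_norm norm_minus_commute)
        have "norm (fst u) \<le> norm u" "norm (snd u) \<le> norm u" for u :: "'a \<times> 'a dual"
          by (cases u; simp add: norm_fst_le norm_snd_le)+
        from this[of "b - z0"] b have "norm (fst (b - z0)) \<le> 1" "norm (snd (b - z0)) \<le> 1"
          by linarith+
        then have "square_kernel (b - z0) \<le> 1"
          unfolding square_kernel_def by (simp add: power_le_one field_simps) 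
            (smt (verit) norm_ge_zero power_le_one)
        moreover have "norm b \<le> norm z0 + 1"
          using b norm_triangle_sub[of b z0] by simp
        then have "norm z0 * norm b \<le> norm z0 * (norm z0 + 1)"
          by (rule mult_left_mono) simp
        ultimately show ?thesis
          using abs_pairing_le[of z0 b] unfolding \<psi>_def by linarith
      qed
      show "0 \<le> r + \<psi> a" if "(a, r) \<in> P" for a r
      proof -
        have "duality_product a \<le> r"
          using order_trans[OF ge[of a]] that by (fastforce simp: P_def)
        then show ?thesis
          using square_kernel_ge[of "a - z0"] duality_product_diff[of a z0] pairing_commute[of a z0]
          unfolding \<psi>_def by linarith
      qed
    qed
    then obtain l where l: "bounded_linear l" "\<And>a r b. (a, r) \<in> P \<Longrightarrow> l (a - b) \<le> r + \<psi> b"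
      by blast
    obtain y where y: "\<And>z. l z = pairing z y"
      using reflexive_functional[OF refl l(1)] by blast
    obtain p where p: "pairing p (y - z0) + square_kernel p \<le> - square_kernel (y - z0)"
      using square_kernel_conjugate_attained[OF refl] by blast
    have "pairing a y - r \<le> pairing z0 y - duality_product z0 - square_kernel (y - z0)"
      if "R a \<le> ereal r" for a r
    proof -
      have "pairing (a - (z0 + p)) y \<le> r + \<psi> (z0 + p)"
        using l(2)[of a r "z0 + p"] that by (simp add: y P_def)
      moreover have "\<psi> (z0 + p) = square_kernel p - duality_product z0 - pairing p z0"
        using pairing_self[of z0] pairing_commute[of z0 p] by (simp add: \<psi>_def pairing.add_right)
      ultimately show ?thesis
        using p by (simp add: pairing.diff_left pairing.diff_right pairing.add_left)
    qed
    then have R_y: "R y \<le> ereal (pairing z0 y - duality_product z0 - square_kernel (y - z0))"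
      unfolding R_le_iff[of y] by blast
    have eq: "duality_product (y - z0) = duality_product y + duality_product z0 - pairing z0 y"
      unfolding duality_product_diff by (simp add: pairing_commute)
    have "R y \<le> ereal (duality_product y)"
      using order_trans[OF R_y] square_kernel_ge[of "y - z0"] unfolding eq by simp
    then have "y \<in> ?A" using ge[of y] by (simp add: antisym)
    then have "0 \<le> duality_product (y - z0)"
      using B unfolding monotone_operator_iff by blast
    moreover have "duality_product y \<le> pairing z0 y - duality_product z0 - square_kernel (y - z0)"
      using order_trans[OF ge R_y] by simp
    ultimately have "square_kernel (y - z0) \<le> 0"
      unfolding eq by simp
    then have "y = z0"
      using square_kernel_zero[of "y - z0"] by simp
    then show ?thesis using \<open>y \<in> ?A\<close> by simp
  qed
  ultimately show ?thesis
    unfolding maximal_monotone_operator_def by blast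
qed

section \<open>The Fitzpatrick function restricted to the closed convex hull of the domain\<close>

lemma fitzpatrick_le_iff:
  "fitzpatrick A z \<le> ereal r \<longleftrightarrow> (\<forall>a\<in>A. pairing z a - duality_product a \<le> r)"
proof -
  have "fitzpatrick A z = (SUP (v, x). ereal (pairing z (x, v)) - c_op A (v, x))"
    by (cases z) (auto simp: fitzpatrick_def conjugate_dual_def pairing_def add.commute intro!: SUP_cong)
  moreover have "ereal (pairing z (x, v)) - c_op A (v, x) \<le> ereal r
      \<longleftrightarrow> ((x, v) \<in> A \<longrightarrow> pairing z (x, v) - blinfun_apply v x \<le> r)" for x v
    by (simp add: c_op_def)
  ultimately show ?thesis by (auto simp: SUP_le_iff case_prod_beta)
qed

lemma fitzpatrick_ge: "a \<in> A \<Longrightarrow> ereal (pairing z a - duality_product a) \<le> fitzpatrick A z"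
  by (rule ereal_le_real) (auto simp: fitzpatrick_le_iff)

lemma fitzpatrick_on_monotone:
  assumes "monotone_operator A" "a \<in> A"
  shows "fitzpatrick A a \<le> ereal (duality_product a)"
  unfolding fitzpatrick_le_iff
proof
  fix b assume "b \<in> A"
  then have "0 \<le> duality_product (a - b)"
    using assms unfolding monotone_operator_iff by blast
  then show "pairing a b - duality_product b \<le> duality_product a"
    unfolding duality_product_diff by simp
qed

definition restricted_fitzpatrick ::
  "('a::real_normed_vector \<times> 'a dual) set \<Rightarrow> 'a set \<Rightarrow> 'a \<times> 'a dual \<Rightarrow> ereal" where
  "restricted_fitzpatrick A D z = fitzpatrick A z + indicator_ereal (D \<times> UNIV) z"

lemma restricted_fitzpatrick_le_iff:
  "restricted_fitzpatrick A D z \<le> ereal r \<longleftrightarrow> fst z \<in> D \<and> fitzpatrick A z \<le> ereal r"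
  by (cases "fst z \<in> D"; cases "fitzpatrick A z")
    (auto simp: restricted_fitzpatrick_def indicator_ereal_def mem_Times_iff)

lemma fitzpatrick_le_restricted: "fitzpatrick A z \<le> restricted_fitzpatrick A D z"
  by (rule ereal_leI_upper) (simp add: restricted_fitzpatrick_le_iff)

lemma restricted_fitzpatrick_ge:
  "a \<in> A \<Longrightarrow> ereal (pairing z a - duality_product a) \<le> restricted_fitzpatrick A D z"
  using fitzpatrick_ge fitzpatrick_le_restricted order_trans by blast

lemma convex_erealI:
  assumes proper: "\<And>z. h z \<noteq> - \<infinity>"
    and epi: "\<And>y z r s t. h y \<le> ereal r \<Longrightarrow> h z \<le> ereal s \<Longrightarrow> 0 < t \<Longrightarrow> t < 1 \<Longrightarrow>
      h ((1 - t) *\<^sub>R y + t *\<^sub>R z) \<le> ereal ((1 - t) * r + t * s)"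
  shows "convex_ereal h"
  unfolding convex_ereal_def
proof (intro allI ballI)
  fix y z and t :: real assume t: "t \<in> {0<..<1}"
  show "h ((1 - t) *\<^sub>R y + t *\<^sub>R z) \<le> ereal (1 - t) * h y + ereal t * h z"
  proof (cases "h y"; cases "h z")
    fix r s assume "h y = ereal r" "h z = ereal s"
    then show ?thesis using epi[of y r z s t] t by simp
  qed (use proper[of y] proper[of z] t in auto)
qed

lemma restricted_fitzpatrick_convex:
  assumes "A \<noteq> {}" "convex D"
  shows "convex_ereal (restricted_fitzpatrick A D)"
proof (rule convex_erealI)
  obtain a where "a \<in> A" using assms(1) by blast
  then show "restricted_fitzpatrick A D z \<noteq> - \<infinity>" for z
    using restricted_fitzpatrick_ge[of a A z D] by auto
  fix y z r s and t :: real
  assume y: "restricted_fitzpatrick A D y \<le> ereal r" and z: "restricted_fitzpatrick A D z \<le> ereal s"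
    and t: "0 < t" "t < 1"
  have "fst ((1 - t) *\<^sub>R y + t *\<^sub>R z) \<in> D"
    using y z t assms(2) by (auto simp: restricted_fitzpatrick_le_iff convex_alt)
  moreover have "pairing ((1 - t) *\<^sub>R y + t *\<^sub>R z) a - duality_product a \<le> (1 - t) * r + t * s"
    if "a \<in> A" for a
  proof -
    have "(1 - t) * (pairing y a - duality_product a) + t * (pairing z a - duality_product a)
        \<le> (1 - t) * r + t * s"
      using y z t that
      by (intro add_mono mult_left_mono) (auto simp: restricted_fitzpatrick_le_iff fitzpatrick_le_iff)
    then show ?thesis
      by (simp add: pairing.add_left pairing.scaleR_left) (simp add: algebra_simps)
  qed
  ultimately show "restricted_fitzpatrick A D ((1 - t) *\<^sub>R y + t *\<^sub>R z) \<le> ereal ((1 - t) * r + t * s)"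
    by (auto simp: restricted_fitzpatrick_le_iff fitzpatrick_le_iff)
qed

text \<open>Semicontinuity holds because the function is a supremum of continuous affine functions on a
  closed set and infinite off it.\<close>

lemma restricted_fitzpatrick_lsc:
  assumes D: "closed D" and ne: "A \<noteq> {}"
  shows "lower_semicontinuous (restricted_fitzpatrick A D)"
proof (rule lower_semicontinuousI)
  fix e z assume e: "e < restricted_fitzpatrick A D z"
  show "\<forall>\<^sub>F y in at z. e < restricted_fitzpatrick A D y"
  proof (cases e)
    case (real r)
    then have "\<not> restricted_fitzpatrick A D z \<le> ereal r" using e by simp
    then consider "fst z \<in> - D" | a where "a \<in> A" "r < pairing z a - duality_product a"
      unfolding restricted_fitzpatrick_le_iff fitzpatrick_le_iff by fastforce
    then show ?thesis
    proof cases
      case 1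
      then have "\<forall>\<^sub>F y in at z. fst y \<in> - D"
        using D by (intro topological_tendstoD[OF tendsto_fst[OF tendsto_ident_at]]) auto
      then show ?thesis
      proof eventually_elim
        case (elim y)
        then have "\<not> restricted_fitzpatrick A D y \<le> ereal r"
          unfolding restricted_fitzpatrick_le_iff by simp
        then show ?case using real by simp
      qed
    next
      case (2 a)
      have "((\<lambda>y. pairing y a - duality_product a) \<longlongrightarrow> pairing z a - duality_product a) (at z)"
        by (intro tendsto_intros pairing.tendsto)
      then have "\<forall>\<^sub>F y in at z. r < pairing y a - duality_product a"
        using 2(2) by (rule order_tendstoD)
      then show ?thesis
      proof eventually_elim
        case (elim y)
        then have "ereal r < ereal (pairing y a - duality_product a)" by simp
        also have "\<dots> \<le> restricted_fitzpatrick A D y"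
          by (rule restricted_fitzpatrick_ge[OF 2(1)])
        finally show ?case using real by simp
      qed
    qed
  next
    case PInf
    then show ?thesis using e by simp
  next
    case MInf
    obtain a where "a \<in> A" using ne by blast
    then have "e < restricted_fitzpatrick A D y" for y
      using MInf restricted_fitzpatrick_ge[of a A y D] by (auto intro: less_le_trans[of _ "ereal _"])
    then show ?thesis by simp
  qed
qed

text \<open>Let a functional \<open>w\<close> separate \<open>fst z\<close> strictly from \<open>D\<close>. Moving from a point of \<open>A\<close> in the
  direction \<open>(0, w)\<close>, the function grows at most at the rate \<open>sup w\<close> over \<open>D\<close>, whereas the pairing
  with \<open>z\<close> grows faster; hence the supremum defining the conjugate at \<open>z\<close> is infinite.\<close>

lemma conjugate_restricted_fitzpatrick_domain:
  assumes mono: "monotone_operator A" and ne: "A \<noteq> {}"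
    and D: "closed D" "convex D" "Domain A \<subseteq> D"
    and z: "tconj (restricted_fitzpatrick A D) z \<le> ereal r"
  shows "fst z \<in> D"
proof (rule ccontr)
  assume out: "fst z \<notin> D"
  obtain a where a: "a \<in> A" using ne by blast
  have in_D: "fst b \<in> D" if "b \<in> A" for b
    using D(3) that by (cases b) auto
  obtain l :: "_ \<Rightarrow> real" where l: "bounded_linear l" "\<And>x. x \<in> D \<Longrightarrow> l x + 1 \<le> l (fst z)"
    using closed_convex_separation[OF D(1,2) _ out] in_D[OF a] by blast
  define w where "w = Blinfun l"
  have w: "blinfun_apply w x = l x" for x
    by (simp add: w_def bounded_linear_Blinfun_apply[OF l(1)])
  have "t \<le> duality_product a + r - pairing a z" if t: "0 \<le> t" for t
  proof -
    let ?y = "a + t *\<^sub>R (0, w)"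
    have w_pairing: "pairing (0, w) b = l (fst b)" for b
      by (simp add: pairing_def w)
    have "restricted_fitzpatrick A D ?y \<le> ereal (duality_product a + t * (l (fst z) - 1))"
      unfolding restricted_fitzpatrick_le_iff fitzpatrick_le_iff
    proof (intro conjI ballI)
      show "fst ?y \<in> D" using in_D[OF a] by simp
      fix b assume b: "b \<in> A"
      have "pairing a b - duality_product b \<le> duality_product a"
        using fitzpatrick_on_monotone[OF mono a] b unfolding fitzpatrick_le_iff by blast
      moreover have "t * l (fst b) \<le> t * (l (fst z) - 1)"
        using l(2)[OF in_D[OF b]] t by (intro mult_left_mono) auto
      ultimately show "pairing ?y b - duality_product b \<le> duality_product a + t * (l (fst z) - 1)"
        by (simp only: pairing.add_left pairing.scaleR_left w_pairing real_scaleR_def)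
    qed
    then have "pairing ?y z - (duality_product a + t * (l (fst z) - 1)) \<le> r"
      using z unfolding tconj_le_iff by blast
    then show ?thesis
      by (simp only: pairing.add_left pairing.scaleR_left w_pairing real_scaleR_def)
        (simp add: algebra_simps)
  qed
  from this[of "\<bar>duality_product a + r - pairing a z\<bar> + 1"] show False by simp
qed

text \<open>The points of \<open>A\<close> serve as test points in the conjugate, as the Fitzpatrick function is at most
  the duality product there. Off \<open>D\<close> the conjugate is infinite.\<close>

lemma restricted_fitzpatrick_le_tconj:
  assumes mono: "monotone_operator A" and ne: "A \<noteq> {}"
    and D: "closed D" "convex D" "Domain A \<subseteq> D"
  shows "restricted_fitzpatrick A D z \<le> tconj (fitzpatrick A) z"
proof (rule ereal_leI_upper)
  fix r assume r: "tconj (fitzpatrick A) z \<le> ereal r"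
  have "tconj (restricted_fitzpatrick A D) z \<le> ereal r"
    by (rule order_trans[OF tconj_antimono[OF fitzpatrick_le_restricted] r])
  then have "fst z \<in> D"
    by (rule conjugate_restricted_fitzpatrick_domain[OF assms])
  moreover have "pairing z a - duality_product a \<le> r" if a: "a \<in> A" for a
    using r fitzpatrick_on_monotone[OF mono a] unfolding tconj_le_iff pairing_commute[of z a] by blast
  ultimately show "restricted_fitzpatrick A D z \<le> ereal r"
    unfolding restricted_fitzpatrick_le_iff fitzpatrick_le_iff by blast
qed

theorem theorem2p3:
  fixes A A' C :: "('a::banach \<times> 'a dual) set"
    and D :: "'a set"
    and f :: "'a \<times> 'a dual \<Rightarrow> ereal"
    and \<psi> :: "'a \<times> 'a dual \<Rightarrow> real"
  assumes "reflexive TYPE('a)"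
    and "A \<noteq> {}" and "monotone_operator A"
    and D_eq: "D = closure (convex hull (Domain A))"
    and C_eq: "C = D \<times> UNIV"
    and f_eq: "f = (\<lambda>z. fitzpatrick A z + indicator_ereal C z)"
    and "self_dual_kernel \<psi>"
    and A'_eq: "A' = {(x, v). R_fun \<psi> f (x, v) = ereal (blinfun_apply v x)}"
  shows "((\<forall>z. f z \<noteq> -\<infinity>) \<and> lower_semicontinuous f \<and> convex_ereal f \<and>
            fitzpatrick A \<le> f \<and> f \<le> swap_args (p_op A)) \<and>
         (eff_domain f \<subseteq> C \<and> eff_domain (conjugate f) \<subseteq> UNIV \<times> D) \<and>
         ((\<forall>z. \<exists>z1 z2. z = (1/2) *\<^sub>R (z1 + z2) \<and> R_fun \<psi> f z = R_cost \<psi> f z1 z2) \<and>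
          eff_domain (R_fun \<psi> f) \<subseteq> C \<and>
          maximal_monotone_operator A' \<and> A \<subseteq> A' \<and> Domain A' \<subseteq> D)"
proof -
  note mono = \<open>monotone_operator A\<close> and ne = \<open>A \<noteq> {}\<close>
  have D: "closed D" "convex D" "Domain A \<subseteq> D"
    unfolding D_eq using closure_subset[of "convex hull Domain A"] hull_subset[of "Domain A" convex]
    by (auto intro: convex_closure convex_convex_hull)
  have f: "f = restricted_fitzpatrick A D"
    by (simp add: f_eq C_eq restricted_fitzpatrick_def[abs_def])
  obtain a0 where a0: "a0 \<in> A" using ne by blast
  have f_A: "f a \<le> ereal (duality_product a)" if a: "a \<in> A" for a
    using fitzpatrick_on_monotone[OF mono a] D(3) a
    by (cases a) (auto simp: f restricted_fitzpatrick_le_iff)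
  have lsc: "lower_semicontinuous f"
    unfolding f by (rule restricted_fitzpatrick_lsc[OF D(1) ne])
  have conv: "convex_ereal f"
    unfolding f by (rule restricted_fitzpatrick_convex[OF ne D(2)])
  interpret conjugate_pair f \<psi> a0 a0 "duality_product a0" "duality_product a0"
  proof
    show "ereal (pairing z a0 - duality_product a0) \<le> f z" for z
      unfolding f by (rule restricted_fitzpatrick_ge[OF a0])
  qed (fact assms lsc conv f_A[OF a0])+
  have dom_f: "fst z \<in> D" if "f z \<le> ereal r" for z r
    using that by (simp add: f restricted_fitzpatrick_le_iff)
  have dom_conj: "fst z \<in> D" if "tconj f z \<le> ereal r" for z r
    using conjugate_restricted_fitzpatrick_domain[OF mono ne D] that unfolding f by blast
  have below_infinity: "\<exists>r. e \<le> ereal r" if "e < \<infinity>" for e :: ereal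
    using that by (cases e) auto
  have f_le_p: "f \<le> swap_args (p_op A)"
    unfolding p_op_def f le_fun_def using restricted_fitzpatrick_le_tconj[OF mono ne D] by blast
  have f_ge: "fitzpatrick A \<le> f"
    unfolding f le_fun_def using fitzpatrick_le_restricted by blast
  have part2: "eff_domain f \<subseteq> C" "eff_domain (conjugate f) \<subseteq> UNIV \<times> D"
  proof -
    show "eff_domain f \<subseteq> C"
      using below_infinity dom_f by (fastforce simp: eff_domain_def C_eq mem_Times_iff)
    have "x \<in> D" if "conjugate f (v, x) < \<infinity>" for v x
      using below_infinity[OF that] dom_conj[of "(x, v)"] by (auto simp: swap_args_def)
    then show "eff_domain (conjugate f) \<subseteq> UNIV \<times> D"
      by (auto simp: eff_domain_def)
  qed
  have dom_R: "fst z \<in> D" if fin: "R_fun \<psi> f z < \<infinity>" for z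
  proof -
    obtain y1 y2 where y: "z = (1/2) *\<^sub>R (y1 + y2)" "R_fun \<psi> f z = R_cost \<psi> f y1 y2"
      using R_fun_attained by blast
    then obtain r where "R_cost \<psi> f y1 y2 \<le> ereal r"
      using below_infinity[OF fin] by auto
    then have "fst y1 \<in> D" "fst y2 \<in> D"
      unfolding R_cost_le_iff using dom_f dom_conj by blast+
    then have "(1/2) *\<^sub>R fst y1 + (1/2) *\<^sub>R fst y2 \<in> D"
      by (intro convexD[OF D(2)]) auto
    then show ?thesis by (simp add: y(1) scaleR_add_right)
  qed
  have A': "A' = {z. R_fun \<psi> f z = ereal (duality_product z)}"
    by (auto simp: A'_eq)
  have R_A: "R_fun \<psi> f a \<le> ereal (duality_product a)" if a: "a \<in> A" for a
  proof -
    have "pairing z a - t \<le> duality_product a" if "f z \<le> ereal t" for z t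
      using order_trans[OF restricted_fitzpatrick_ge[OF a, of z D]] that by (fastforce simp: f)
    then have "tconj f a \<le> ereal (duality_product a)"
      unfolding tconj_le_iff by blast
    then have "R_cost \<psi> f a a \<le> ereal (duality_product a)"
      unfolding R_cost_le_iff using f_A[OF a] self_dual_kernel_zero[OF kernel]
      by (intro exI[of _ "duality_product a"]) auto
    moreover have "a = (1/2) *\<^sub>R (a + a)" by (simp flip: scaleR_2)
    ultimately show ?thesis
      using R_fun_le_R_cost order_trans by blast
  qed
  then have "A \<subseteq> A'"
    unfolding A' using duality_product_le_R_fun by (auto intro: antisym)
  moreover have "maximal_monotone_operator A'"
    unfolding A'
    by (rule self_dual_representative_maximal_monotone
        [OF reflexivity R_fun_self_dual R_A[OF a0] duality_product_le_R_fun])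
  moreover have "eff_domain (R_fun \<psi> f) \<subseteq> C"
    using dom_R by (auto simp: eff_domain_def C_eq mem_Times_iff)
  moreover have "Domain A' \<subseteq> D"
  proof
    fix x assume "x \<in> Domain A'"
    then obtain v where "R_fun \<psi> f (x, v) = ereal (blinfun_apply v x)"
      by (auto simp: A')
    then show "x \<in> D" using dom_R[of "(x, v)"] by simp
  qed
  ultimately show ?thesis
    using f_proper lsc conv f_ge f_le_p part2 R_fun_attained by blast
qed

end
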